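(* Let $\mathbf X=(X,\mathcal E)$ be a coarse space and let $\mathcal H_{\mathbf X}$ be a discrete $\mathbf X$-module that is $\kappa$-ample of local rank at most $\kappa$, where $\kappa>0$ is arbitrary. Then there is a canonical isomorphism $$\rho\colon\mathrm{CE}(\mathbf X)\xrightarrow{\ \cong\ }\mathrm{CtrUni}(\mathcal H_{\mathbf X})/U(\mathbb C_{\mathrm{cp}}[\mathcal H_{\mathbf X}]).$$
   Context: Here $\kappa$ is a cardinal and the isomorphism is one of groups. Relations. For subsets of $X\times X$: $R^{T}=\{(x,y):(y,x)\in R\}$; $R_2\circ R_1=\{(z,x):\exists y,\ (z,y)\in R_2,\ (y,x)\in R_1\}$; $R(A)=\{y:\exists a\in A,\ (y,a)\in R\}$. $B,A\subseteq X$ are $R$-separated if $B\cap R(A)=\emptyset$. A coarse structure on $X$ is a non-empty family $\mathcal E$ of subsets of $X\times X$, closed under subsets and finite unions, containing the diagonal $\Delta_X$, and closed under $E\mapsto E^T$ and under composition; a coarse space is a set with a coarse structure. A gauge is a symmetric element of $\mathcal E$ containing $\Delta_X$. $A\subseteq X$ is $E$-bounded if $A\times A\subseteq E$, and bounded if $A\times A\in\mathcal E$. $A\subseteq X$ is coarsely dense if $X=E(A)$ for some $E\in\mathcal E$. For relations $R,R'\subseteq X\times X$ write $R'\preccurlyeq R$ if $R'\subseteq F\circ R\circ E$ for some $E,F\in\mathcal E$, and $R\asymp R'$ if $R\preccurlyeq R'\preccurlyeq R$; a coarse subspace of $\mathbf X\times\mathbf X$ is an $\asymp$-class $[R]$.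 $R$ is controlled if $R\circ E\circ R^T\in\mathcal E$ for all $E\in\mathcal E$; $[R]$ is then a partial coarse map, and a coarse map $\mathbf X\to\mathbf X$ if in addition the projection of $R$ to the second coordinate (its domain) is coarsely dense. Coarse maps can be represented by (relations $\{(f(x),x)\}$ of) functions $f\colon X\to X$, and are composed by composing representing functions. A coarse equivalence is a coarse map $\mathbf f$ for which there is a coarse map $\mathbf g$ with $\mathbf f\circ\mathbf g=\mathbf g\circ\mathbf f=[\Delta_X]$. $\mathrm{CE}(\mathbf X)$ is the group of coarse equivalences $\mathbf X\to\mathbf X$ under composition. An $\mathbf X$-module consists of a Boolean algebra $\mathfrak A$ of subsets of $X$ with $X\in\mathfrak A$ (its members are called measurable), a Hilbert space $\mathcal H$, and a map $\mathbb 1_\bullet$ from $\mathfrak A$ to projections in $\mathcal B(\mathcal H)$ with $\mathbb 1_\emptyset=0$, $\mathbb 1_X=1$, $\mathbb 1_{A\cap B}=\mathbb 1_A\mathbb 1_B$, $\mathbb 1_{A\cup B}=\mathbb 1_A+\mathbb 1_B-\mathbb 1_A\mathbb 1_B$, non-degenerate: for some gauge $\widetilde E$ the subspaces $\mathbb 1_A(\mathcal H)$ with $A$ measurable and $\widetilde E$-bounded span a dense subspace. It is $\kappa$-ample if for some gauge $\widetilde E$ the union of all measurable $\widetilde E$-bounded $A$ with $\mathbb 1_A\neq0$ is coarsely dense and $\mathbb 1_A$ has rank at least $\kappa$ for each such $A$. The rank of a projection is the cardinality of an orthonormal basis of its image; the module has local rank at most $\kappa$ if $\mathbb 1_A$ has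 rank at most $\kappa$ for every bounded measurable $A$. The module is discrete if there are a gauge $\widetilde E$ and a partition $X=\bigsqcup_{i\in I}A_i$ into measurable $\widetilde E$-bounded sets with $\sum_i\mathbb 1_{A_i}=1$ strongly, and such that every $C\subseteq X$ with $C\cap A_i\in\mathfrak A$ for all $i$ is in $\mathfrak A$. For $t\in\mathcal B(\mathcal H_{\mathbf X})$ and $S\subseteq X\times X$, $\mathrm{Supp}(t)\subseteq S$ means $\mathbb 1_Bt\mathbb 1_A=0$ for all $S$-separated measurable $B,A$. The coarse support $\mathbf{Supp}(t)$ is the (unique, always existing) coarse subspace $[S]$ with $\mathrm{Supp}(t)\subseteq S$ and $S\preccurlyeq R$ whenever $\mathrm{Supp}(t)\subseteq R$. $t$ is controlled if $\mathbf{Supp}(t)$ is a partial coarse map; $t$ has controlled propagation if $\mathrm{Supp}(t)\subseteq E$ for some $E\in\mathcal E$. $\mathbb C_{\mathrm{cp}}[\mathcal H_{\mathbf X}]$ is the $*$-algebra of operators of controlled propagation, $U(\cdot)$ its group of unitaries. $\mathrm{CtrUni}(\mathcal H_{\mathbf X})$ is the group of unitaries $u$ on $\mathcal H_{\mathbf X}$ such that both $u$ and $u^*$ are controlled; $U(\mathbb C_{\mathrm{cp}}[\mathcal H_{\mathbf X}])$ is a normal subgroup of it. *)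

theory Defs
  imports "HOL-Analysis.Analysis" "HOL-Algebra.Coset"
begin

unbundle cardinal_syntax

section \<open>Complex Hilbert spaces\<close>

text \<open>A complex inner product space is a real one with a compatible complex structure:
  the real inner product (hence norm and topology) is the real part of the complex one.
  The complex inner product is linear in its first argument.\<close>

class complex_inner = real_inner +
  fixes scaleC :: "complex \<Rightarrow> 'a \<Rightarrow> 'a"  (infixr "*\<^sub>C" 75)
    and cinner :: "'a \<Rightarrow> 'a \<Rightarrow> complex"
  assumes scaleC_add_right: "c *\<^sub>C (x + y) = c *\<^sub>C x + c *\<^sub>C y"
    and scaleC_add_left: "(c + d) *\<^sub>C x = c *\<^sub>C x + d *\<^sub>C x"
    and scaleC_scaleC: "c *\<^sub>C d *\<^sub>C x = (c * d) *\<^sub>C x"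
    and scaleR_scaleC: "scaleR r x = complex_of_real r *\<^sub>C x"
    and cinner_commute: "cinner x y = cnj (cinner y x)"
    and cinner_add_left: "cinner (x + y) z = cinner x z + cinner y z"
    and cinner_scaleC_left: "cinner (c *\<^sub>C x) y = c * cinner x y"
    and inner_eq_Re_cinner: "inner x y = Re (cinner x y)"

class chilbert_space = complex_inner + complete_space

lemma scaleC_one: "1 *\<^sub>C x = (x :: 'a::complex_inner)"
  using scaleR_scaleC[of 1 x] by simp

global_interpretation complex_vector: vector_space "scaleC :: complex \<Rightarrow> 'a \<Rightarrow> 'a :: complex_inner"
  defines cspan = complex_vector.span
  by unfold_locales (simp_all add: scaleC_add_right scaleC_add_left scaleC_scaleC scaleC_one)

instantiation complex :: chilbert_space
begin
definition scaleC_complex :: "complex \<Rightarrow> complex \<Rightarrow> complex" where "scaleC_complex c x = c * x"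
definition cinner_complex :: "complex \<Rightarrow> complex \<Rightarrow> complex" where "cinner_complex x y = x * cnj y"
instance
  by standard (simp_all add: scaleC_complex_def cinner_complex_def algebra_simps scaleR_conv_of_real
      inner_complex_def)
end

definition bounded_clinear :: "('h::complex_inner \<Rightarrow> 'h) \<Rightarrow> bool" where
  "bounded_clinear t \<longleftrightarrow> bounded_linear t \<and> (\<forall>c x. t (c *\<^sub>C x) = c *\<^sub>C t x)"

definition cadjoint :: "('h::complex_inner \<Rightarrow> 'h) \<Rightarrow> 'h \<Rightarrow> 'h" where
  "cadjoint t = (THE s. \<forall>x y. cinner (t x) y = cinner x (s y))"

definition is_projection :: "('h::complex_inner \<Rightarrow> 'h) \<Rightarrow> bool" where
  "is_projection p \<longleftrightarrow> bounded_clinear p \<and> p \<circ> p = p \<and> cadjoint p = p"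

definition unitary :: "('h::complex_inner \<Rightarrow> 'h) \<Rightarrow> bool" where
  "unitary u \<longleftrightarrow> bounded_clinear u \<and> cadjoint u \<circ> u = id \<and> u \<circ> cadjoint u = id"

definition orthonormal_basis :: "'h::complex_inner set \<Rightarrow> 'h set \<Rightarrow> bool" where
  "orthonormal_basis V B \<longleftrightarrow>
     (\<forall>x\<in>B. \<forall>y\<in>B. cinner x y = (if x = y then 1 else 0)) \<and> closure (cspan B) = V"

definition projection_rank :: "('h::complex_inner \<Rightarrow> 'h) \<Rightarrow> 'h rel" where
  "projection_rank p = |SOME B. orthonormal_basis (range p) B|"


section \<open>Coarse spaces\<close>

text \<open>A pair \<open>(y, x)\<close> in a relation is read as going from \<open>x\<close> to \<open>y\<close>.  With this convention
  the composition of relations \<open>R2 \<circ> R1\<close> is \<open>R2 O R1\<close>, the transpose is \<open>R\<inverse>\<close>, and the domain of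
  a relation (its projection to the second coordinate) is \<open>Range R\<close>.\<close>

definition rel_image :: "('a \<times> 'a) set \<Rightarrow> 'a set \<Rightarrow> 'a set" where
  "rel_image R A = {y. \<exists>a\<in>A. (y, a) \<in> R}"

definition separated :: "('a \<times> 'a) set \<Rightarrow> 'a set \<Rightarrow> 'a set \<Rightarrow> bool" where
  "separated R B A \<longleftrightarrow> B \<inter> rel_image R A = {}"

definition coarse_space :: "'a set \<Rightarrow> ('a \<times> 'a) set set \<Rightarrow> bool" where
  "coarse_space X \<E> \<longleftrightarrow>
     \<E> \<noteq> {} \<and> \<E> \<subseteq> Pow (X \<times> X) \<and>
     (\<forall>E\<in>\<E>. \<forall>F. F \<subseteq> E \<longrightarrow> F \<in> \<E>) \<and>
     (\<forall>E\<in>\<E>. \<forall>F\<in>\<E>. E \<union> F \<in> \<E>) \<and>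
     Id_on X \<in> \<E> \<and>
     (\<forall>E\<in>\<E>. E\<inverse> \<in> \<E>) \<and>
     (\<forall>E\<in>\<E>. \<forall>F\<in>\<E>. E O F \<in> \<E>)"

definition coarse_gauge :: "'a set \<Rightarrow> ('a \<times> 'a) set set \<Rightarrow> ('a \<times> 'a) set \<Rightarrow> bool" where
  "coarse_gauge X \<E> E \<longleftrightarrow> E \<in> \<E> \<and> E\<inverse> = E \<and> Id_on X \<subseteq> E"

definition coarsely_dense :: "'a set \<Rightarrow> ('a \<times> 'a) set set \<Rightarrow> 'a set \<Rightarrow> bool" where
  "coarsely_dense X \<E> A \<longleftrightarrow> A \<subseteq> X \<and> (\<exists>E\<in>\<E>. X = rel_image E A)"

definition coarse_le :: "('a \<times> 'a) set set \<Rightarrow> ('a \<times> 'a) set \<Rightarrow> ('a \<times> 'a) set \<Rightarrow> bool" where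
  "coarse_le \<E> R' R \<longleftrightarrow> (\<exists>E\<in>\<E>. \<exists>F\<in>\<E>. R' \<subseteq> F O R O E)"

definition coarse_class :: "'a set \<Rightarrow> ('a \<times> 'a) set set \<Rightarrow> ('a \<times> 'a) set \<Rightarrow> ('a \<times> 'a) set set" where
  "coarse_class X \<E> R = {R'. R' \<subseteq> X \<times> X \<and> coarse_le \<E> R' R \<and> coarse_le \<E> R R'}"

definition controlled_rel :: "('a \<times> 'a) set set \<Rightarrow> ('a \<times> 'a) set \<Rightarrow> bool" where
  "controlled_rel \<E> R \<longleftrightarrow> (\<forall>E\<in>\<E>. R O E O R\<inverse> \<in> \<E>)"

definition partial_coarse_map :: "'a set \<Rightarrow> ('a \<times> 'a) set set \<Rightarrow> ('a \<times> 'a) set set \<Rightarrow> bool" where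
  "partial_coarse_map X \<E> C \<longleftrightarrow>
     (\<exists>R. R \<subseteq> X \<times> X \<and> C = coarse_class X \<E> R \<and> controlled_rel \<E> R)"

definition coarse_map :: "'a set \<Rightarrow> ('a \<times> 'a) set set \<Rightarrow> ('a \<times> 'a) set set \<Rightarrow> bool" where
  "coarse_map X \<E> C \<longleftrightarrow>
     (\<exists>R. R \<subseteq> X \<times> X \<and> C = coarse_class X \<E> R \<and> controlled_rel \<E> R \<and>
       coarsely_dense X \<E> (Range R))"

text \<open>The coarse class of a function \<open>X \<rightarrow> X\<close>.\<close>

definition fun_class :: "'a set \<Rightarrow> ('a \<times> 'a) set set \<Rightarrow> ('a \<Rightarrow> 'a) \<Rightarrow> ('a \<times> 'a) set set" where
  "fun_class X \<E> f = coarse_class X \<E> {(f x, x) | x. x \<in> X}"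

text \<open>Coarse maps are composed by composing representing functions; the resulting class does not
  depend on the chosen representatives.\<close>

definition coarse_comp ::
  "'a set \<Rightarrow> ('a \<times> 'a) set set \<Rightarrow> ('a \<times> 'a) set set \<Rightarrow> ('a \<times> 'a) set set \<Rightarrow> ('a \<times> 'a) set set" where
  "coarse_comp X \<E> C D = (THE H. \<exists>f g. f \<in> X \<rightarrow> X \<and> g \<in> X \<rightarrow> X \<and>
     C = fun_class X \<E> f \<and> D = fun_class X \<E> g \<and> H = fun_class X \<E> (f \<circ> g))"

definition coarse_equivalence :: "'a set \<Rightarrow> ('a \<times> 'a) set set \<Rightarrow> ('a \<times> 'a) set set \<Rightarrow> bool" where
  "coarse_equivalence X \<E> C \<longleftrightarrow> coarse_map X \<E> C \<and>
     (\<exists>D. coarse_map X \<E> D \<and>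
        coarse_comp X \<E> C D = coarse_class X \<E> (Id_on X) \<and>
        coarse_comp X \<E> D C = coarse_class X \<E> (Id_on X))"

definition CE :: "'a set \<Rightarrow> ('a \<times> 'a) set set \<Rightarrow> ('a \<times> 'a) set set monoid" where
  "CE X \<E> = \<lparr>carrier = {C. coarse_equivalence X \<E> C},
             mult = coarse_comp X \<E>,
             one = coarse_class X \<E> (Id_on X)\<rparr>"


section \<open>Coarse geometric modules\<close>

text \<open>Here \<open>\<AA>\<close> is the Boolean algebra of measurable sets and \<open>P A\<close> is the projection
  \<open>1\<^sub>A\<close>; the values of \<open>P\<close> on non-measurable sets are irrelevant.  The Hilbert space is the
  whole type \<open>'h\<close>.\<close>

definition coarse_module ::
  "'a set \<Rightarrow> ('a \<times> 'a) set set \<Rightarrow> 'a set set \<Rightarrow> ('a set \<Rightarrow> 'h::chilbert_space \<Rightarrow> 'h) \<Rightarrow> bool" where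
  "coarse_module X \<E> \<AA> P \<longleftrightarrow>
     algebra X \<AA> \<and>
     (\<forall>A\<in>\<AA>. is_projection (P A)) \<and>
     P {} = (\<lambda>v. 0) \<and> P X = id \<and>
     (\<forall>A\<in>\<AA>. \<forall>B\<in>\<AA>. P (A \<inter> B) = P A \<circ> P B) \<and>
     (\<forall>A\<in>\<AA>. \<forall>B\<in>\<AA>. P (A \<union> B) = (\<lambda>v. P A v + P B v - P A (P B v))) \<and>
     (\<exists>E. coarse_gauge X \<E> E \<and>
        closure (cspan (\<Union>A\<in>{A \<in> \<AA>. A \<times> A \<subseteq> E}. range (P A))) = UNIV)"

text \<open>Cardinals are represented as in the library of cardinal orders by arbitrary cardinal
  relations \<open>\<kappa> :: 'k rel\<close>.\<close>

definition ample_module ::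
  "'a set \<Rightarrow> ('a \<times> 'a) set set \<Rightarrow> 'a set set \<Rightarrow> ('a set \<Rightarrow> 'h::chilbert_space \<Rightarrow> 'h) \<Rightarrow>
   'k rel \<Rightarrow> bool" where
  "ample_module X \<E> \<AA> P \<kappa> \<longleftrightarrow>
     (\<exists>E. coarse_gauge X \<E> E \<and>
        coarsely_dense X \<E> (\<Union> {A \<in> \<AA>. A \<times> A \<subseteq> E \<and> P A \<noteq> (\<lambda>v. 0)}) \<and>
        (\<forall>A\<in>\<AA>. A \<times> A \<subseteq> E \<and> P A \<noteq> (\<lambda>v. 0) \<longrightarrow> \<kappa> \<le>o projection_rank (P A)))"

definition local_rank_le ::
  "('a \<times> 'a) set set \<Rightarrow> 'a set set \<Rightarrow> ('a set \<Rightarrow> 'h::chilbert_space \<Rightarrow> 'h) \<Rightarrow> 'k rel \<Rightarrow> bool" where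
  "local_rank_le \<E> \<AA> P \<kappa> \<longleftrightarrow> (\<forall>A\<in>\<AA>. A \<times> A \<in> \<E> \<longrightarrow> projection_rank (P A) \<le>o \<kappa>)"

definition discrete_module ::
  "'a set \<Rightarrow> ('a \<times> 'a) set set \<Rightarrow> 'a set set \<Rightarrow> ('a set \<Rightarrow> 'h::chilbert_space \<Rightarrow> 'h) \<Rightarrow> bool" where
  "discrete_module X \<E> \<AA> P \<longleftrightarrow>
     (\<exists>E \<P>. coarse_gauge X \<E> E \<and> partition_on X \<P> \<and>
        (\<forall>A\<in>\<P>. A \<in> \<AA> \<and> A \<times> A \<subseteq> E) \<and>
        (\<forall>v. ((\<lambda>A. P A v) has_sum v) \<P>) \<and>
        (\<forall>C. C \<subseteq> X \<and> (\<forall>A\<in>\<P>. C \<inter> A \<in> \<AA>) \<longrightarrow> C \<in> \<AA>))"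


section \<open>Supports and controlled operators\<close>

definition supp_in ::
  "'a set set \<Rightarrow> ('a set \<Rightarrow> 'h::chilbert_space \<Rightarrow> 'h) \<Rightarrow> ('h \<Rightarrow> 'h) \<Rightarrow> ('a \<times> 'a) set \<Rightarrow> bool" where
  "supp_in \<AA> P t S \<longleftrightarrow>
     (\<forall>B\<in>\<AA>. \<forall>A\<in>\<AA>. separated S B A \<longrightarrow> P B \<circ> t \<circ> P A = (\<lambda>v. 0))"

definition coarse_support ::
  "'a set \<Rightarrow> ('a \<times> 'a) set set \<Rightarrow> 'a set set \<Rightarrow> ('a set \<Rightarrow> 'h::chilbert_space \<Rightarrow> 'h) \<Rightarrow>
   ('h \<Rightarrow> 'h) \<Rightarrow> ('a \<times> 'a) set set" where
  "coarse_support X \<E> \<AA> P t = (THE C. \<exists>S. S \<subseteq> X \<times> X \<and> C = coarse_class X \<E> S \<and>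
     supp_in \<AA> P t S \<and> (\<forall>R. R \<subseteq> X \<times> X \<and> supp_in \<AA> P t R \<longrightarrow> coarse_le \<E> S R))"

definition controlled_op ::
  "'a set \<Rightarrow> ('a \<times> 'a) set set \<Rightarrow> 'a set set \<Rightarrow> ('a set \<Rightarrow> 'h::chilbert_space \<Rightarrow> 'h) \<Rightarrow>
   ('h \<Rightarrow> 'h) \<Rightarrow> bool" where
  "controlled_op X \<E> \<AA> P t \<longleftrightarrow> partial_coarse_map X \<E> (coarse_support X \<E> \<AA> P t)"

text \<open>The \<open>*\<close>-algebra of operators of controlled propagation and its unitaries.\<close>

definition Ccp ::
  "('a \<times> 'a) set set \<Rightarrow> 'a set set \<Rightarrow> ('a set \<Rightarrow> 'h::chilbert_space \<Rightarrow> 'h) \<Rightarrow> ('h \<Rightarrow> 'h) set" where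
  "Ccp \<E> \<AA> P = {t. bounded_clinear t \<and> (\<exists>E\<in>\<E>. supp_in \<AA> P t E)}"

definition UCcp ::
  "('a \<times> 'a) set set \<Rightarrow> 'a set set \<Rightarrow> ('a set \<Rightarrow> 'h::chilbert_space \<Rightarrow> 'h) \<Rightarrow> ('h \<Rightarrow> 'h) set" where
  "UCcp \<E> \<AA> P = {u \<in> Ccp \<E> \<AA> P. unitary u}"

definition CtrUni ::
  "'a set \<Rightarrow> ('a \<times> 'a) set set \<Rightarrow> 'a set set \<Rightarrow> ('a set \<Rightarrow> 'h::chilbert_space \<Rightarrow> 'h) \<Rightarrow>
   ('h \<Rightarrow> 'h) monoid" where
  "CtrUni X \<E> \<AA> P =
     \<lparr>carrier = {u. unitary u \<and> controlled_op X \<E> \<AA> P u \<and> controlled_op X \<E> \<AA> P (cadjoint u)},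
      mult = (\<circ>),
      one = id\<rparr>"

end

theory Submission
  imports Defs
begin

text \<open>Assigning to a controlled unitary its coarse support is a homomorphism to the coarse
  equivalences with kernel the unitaries of controlled propagation, so everything rests on
  surjectivity. In a discrete module the coarse support is represented by the union of the
  \<open>B \<times> A\<close>, over blocks \<open>A\<close>, \<open>B\<close> of the partition, with \<open>1\<^sub>B t 1\<^sub>A \<noteq> 0\<close>. Choosing an orthonormal
  basis in every block gives an orthonormal basis of the whole space whose members are located at
  points of \<open>X\<close>. Let \<open>f\<close> be a coarse equivalence with inverse \<open>g\<close>. The basis vectors that \<open>f\<close> sends near a
  given block of full rank live over one bounded set, so there are at most \<open>\<kappa>\<close> of them, and they
  inject into the basis of that block. This gives an injection of the basis into itself that covers
  \<open>f\<close>, and likewise one that covers \<open>g\<close>. The Schroeder--Bernstein construction combines them into a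
  bijection covering \<open>f\<close>, and permuting the basis by it is a unitary with coarse support \<open>[f]\<close>.
  No case distinction between finite and infinite \<open>\<kappa>\<close> is needed.\<close>

section \<open>Hilbert spaces\<close>

text \<open>Supports are only ever bounded from above: in a product, contributions through different
  middle blocks may cancel. This is enough because of a rigidity: a relation with coarsely dense
  domain that lies coarsely below the graph of a controlled function is coarsely equal to that
  graph. For a unitary the density comes from ampleness and injectivity, so each identity between
  coarse supports needs one inequality only.

  The cardinality argument never counts blocks. The vectors competing for one good block form an
  orthonormal set in the image of a single projection, so the local rank bound limits their number
  directly, without cardinal arithmetic. The set carrying that projection may be an infinite union
  of blocks; discreteness makes it measurable. Ampleness speaks of sets unrelated to the partition
  and has to be transferred to blocks first.

  Equinumerosity of bases would not suffice: the bijection must stay near \<open>f\<close> at every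
  single vector, hence a Schroeder-Bernstein statement that records, vector by vector, which
  injection was used.\<close>

text \<open>One variational argument serves two purposes: \<open>W = UNIV\<close> yields adjoints,
  and \<open>f = inner v\<close> yields the orthogonal projection of \<open>v\<close> to
  \<open>W\<close>.\<close>

lemma riesz_on_subspace:
  fixes f :: "'a::{real_inner,complete_space} \<Rightarrow> real"
  assumes W: "subspace W" "closed W" and f: "bounded_linear f"
  obtains w where "w \<in> W" "\<And>h. h \<in> W \<Longrightarrow> f h = inner w h"
proof -
  interpret f: bounded_linear f by fact
  \<comment> \<open>\<open>w\<close> is the minimiser of this functional on \<open>W\<close>.\<close>
  define J where "J x = inner x x - 2 * f x" for x
  obtain K where K: "\<And>x. norm (f x) \<le> norm x * K" using f.bounded by blast
  have J_lower: "J x \<ge> - K\<^sup>2" for x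
  proof -
    have "f x \<le> norm x * K" using K[of x] by simp
    then have "J x + K\<^sup>2 \<ge> (norm x - K)\<^sup>2"
      unfolding J_def by (simp add: power2_norm_eq_inner[symmetric] power2_diff)
    then show ?thesis by (smt (verit) zero_le_power2)
  qed
  have bdd: "bdd_below (J ` W)" using J_lower by (auto intro!: bdd_belowI)
  have W0: "0 \<in> W" using W subspace_0 by blast
  define m where "m = Inf (J ` W)"
  have m_le: "m \<le> J x" if "x \<in> W" for x
    unfolding m_def using bdd that by (intro cInf_lower) auto
  have "\<exists>x\<in>W. J x < m + inverse (real (Suc n))" for n
  proof -
    have "Inf (J ` W) < m + inverse (real (Suc n))" by (simp add: m_def)
    then show ?thesis using cInf_lessD[of "J ` W"] W0 by blast
  qed
  then obtain x where x: "\<And>n. x n \<in> W" "\<And>n. J (x n) < m + inverse (real (Suc n))" by metis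
  \<comment> \<open>Parallelogram law: \<open>J u + J v\<close> minus twice \<open>J\<close> at the
    midpoint is half of the squared distance, and the midpoint lies in \<open>W\<close>, so
    \<open>J\<close> is at least \<open>m\<close> there.\<close>
  have par: "(norm (u - v))\<^sup>2 \<le> 2 * (J u + J v - 2 * m)" if "u \<in> W" "v \<in> W" for u v
  proof -
    have "(1/2) *\<^sub>R (u + v) \<in> W" using W that by (simp add: subspace_add subspace_scale)
    from m_le[OF this]
    have "m \<le> (inner u u + 2 * inner u v + inner v v) / 4 - (f u + f v)"
      unfolding J_def
      by (simp add: f.scaleR f.add inner_add_left inner_add_right inner_commute field_simps)
    then show ?thesis unfolding J_def power2_norm_eq_inner
      by (simp add: inner_diff_left inner_diff_right inner_commute algebra_simps)
  qed
  have "Cauchy x"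
  proof (rule CauchyI)
    fix e :: real assume e: "e > 0"
    \<comment> \<open>Two excesses below \<open>e\<^sup>2 / 4\<close> make the bound in
      \<open>par\<close> smaller than \<open>e\<^sup>2\<close>.\<close>
    obtain N where N: "inverse (real (Suc N)) < e\<^sup>2 / 4"
      using reals_Archimedean[of "e\<^sup>2 / 4"] e by auto
    have "norm (x i - x j) < e" if "i \<ge> N" "j \<ge> N" for i j
    proof -
      have "inverse (real (Suc k)) \<le> inverse (real (Suc N))" if "k \<ge> N" for k
        using that by (simp add: field_simps)
      then have "J (x i) < m + e\<^sup>2 / 4" "J (x j) < m + e\<^sup>2 / 4"
        using x(2)[of i] x(2)[of j] N that by (smt (verit))+
      then have "(norm (x i - x j))\<^sup>2 < e\<^sup>2" using par[OF x(1) x(1), of i j] by argo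
      then show ?thesis using e by (simp add: power_less_imp_less_base)
    qed
    then show "\<exists>M. \<forall>i\<ge>M. \<forall>j\<ge>M. norm (x i - x j) < e" by blast
  qed
  then obtain w where w: "x \<longlonglongrightarrow> w" using Cauchy_convergent_iff convergent_def by blast
  have wW: "w \<in> W" using W(2) w x(1) closed_sequentially by blast
  have "(\<lambda>n. J (x n)) \<longlonglongrightarrow> J w"
    unfolding J_def by (intro tendsto_intros f.tendsto w)
  moreover have "(\<lambda>n. m + inverse (real (Suc n))) \<longlonglongrightarrow> m + 0"
    by (intro tendsto_intros LIMSEQ_inverse_real_of_nat)
  ultimately have Jw: "J w \<le> m"
    using LIMSEQ_le[of "\<lambda>n. J (x n)" "J w" "\<lambda>n. m + inverse (real (Suc n))" "m + 0"] x(2)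
    by (auto intro: less_imp_le)
  have "f h = inner w h" if h: "h \<in> W" for h
  proof -
    define c q where "c = inner w h - f h" and "q = inner h h"
    have q: "q \<ge> 0" by (simp add: q_def)
    \<comment> \<open>The slope of \<open>J\<close> at \<open>w\<close> along \<open>h\<close> is
      \<open>2 * c\<close>, so a step against the sign of \<open>c\<close> would decrease
      \<open>J\<close> unless \<open>c = 0\<close>. Dividing by \<open>q + 1\<close> instead of
      \<open>q\<close> also covers \<open>h = 0\<close>.\<close>
    define t where "t = - c / (q + 1)"
    have "w + t *\<^sub>R h \<in> W" using W wW h by (simp add: subspace_add subspace_scale)
    then have "J w \<le> J (w + t *\<^sub>R h)" using Jw m_le by fastforce
    then have "0 \<le> 2 * t * c + t\<^sup>2 * q"
      unfolding J_def c_def q_def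
      by (simp add: f.scaleR f.add inner_add_left inner_add_right inner_commute
          algebra_simps power2_eq_square)
    moreover have "2 * t * c + t\<^sup>2 * q = - (c\<^sup>2 * (q + 2)) / (q + 1)\<^sup>2"
      unfolding t_def using q by (simp add: divide_simps power2_eq_square) (simp add: algebra_simps)
    ultimately have "c\<^sup>2 * (q + 2) \<le> 0" using q by (simp add: divide_simps split: if_splits)
    then have "c = 0" using q by (simp add: mult_le_0_iff)
    then show ?thesis by (simp add: c_def)
  qed
  with wW show thesis using that by blast
qed

section \<open>Algebra and continuity of the complex inner product\<close>

lemma cinner_add_right: "cinner x (y + z) = cinner x y + cinner x (z::'a::complex_inner)"
  by (metis cinner_add_left cinner_commute complex_cnj_add)

lemma cinner_scaleC_right: "cinner x (c *\<^sub>C y) = cnj c * cinner x (y::'a::complex_inner)"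
  by (metis cinner_scaleC_left cinner_commute complex_cnj_mult)

lemma scaleC_minus_one: "(- 1) *\<^sub>C x = - (x::'a::complex_inner)"
  by (metis complex_vector.scale_minus_left scaleC_one)

lemma cinner_minus_left: "cinner (- x) y = - cinner x (y::'a::complex_inner)"
  by (metis cinner_scaleC_left mult_minus1 scaleC_minus_one)

lemma cinner_diff_left: "cinner (x - z) y = cinner x y - cinner z (y::'a::complex_inner)"
  by (metis cinner_add_left cinner_minus_left diff_conv_add_uminus)

lemma cinner_diff_right: "cinner x (y - z) = cinner x y - cinner x (z::'a::complex_inner)"
  by (metis cinner_diff_left cinner_commute complex_cnj_diff)

lemma cinner_zero_left [simp]: "cinner 0 (y::'a::complex_inner) = 0"
  by (metis cinner_diff_left diff_self)

lemma cinner_zero_right [simp]: "cinner (y::'a::complex_inner) 0 = 0"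
  by (metis cinner_diff_right diff_self)

lemma cinner_sum_left: "cinner (sum f A) (y::'a::complex_inner) = (\<Sum>i\<in>A. cinner (f i) y)"
  by (induction A rule: infinite_finite_induct) (auto simp: cinner_add_left)

lemma cinner_sum_right: "cinner (y::'a::complex_inner) (sum f A) = (\<Sum>i\<in>A. cinner y (f i))"
  by (induction A rule: infinite_finite_induct) (auto simp: cinner_add_right)

lemma cinner_self: "cinner x x = complex_of_real ((norm (x::'a::complex_inner))\<^sup>2)"
proof -
  have "Im (cinner x x) = 0" using cinner_commute[of x x]
    by (metis complex_cnj_cancel_iff Reals_cnj_iff complex_is_Real_iff)
  then show ?thesis using inner_eq_Re_cinner[of x x] by (simp add: complex_eq_iff power2_norm_eq_inner)
qed

lemma cinner_self_eq_0 [simp]: "cinner x x = 0 \<longleftrightarrow> (x::'a::complex_inner) = 0"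
  by (simp add: cinner_self)

lemma cinner_commute_eq_0: "cinner x y = 0 \<longleftrightarrow> cinner y (x::'a::complex_inner) = 0"
  by (metis cinner_commute complex_cnj_zero_iff)

lemma norm_scaleC: "norm (c *\<^sub>C x) = norm c * norm (x::'a::complex_inner)"
proof -
  have "complex_of_real ((norm (c *\<^sub>C x))\<^sup>2) = c * cnj c * complex_of_real ((norm x)\<^sup>2)"
    by (simp only: cinner_self[symmetric] cinner_scaleC_left cinner_scaleC_right) simp
  also have "\<dots> = complex_of_real ((norm c * norm x)\<^sup>2)"
    by (simp add: complex_norm_square[symmetric] power_mult_distrib)
  finally have "(norm (c *\<^sub>C x))\<^sup>2 = (norm c * norm x)\<^sup>2" using of_real_eq_iff by blast
  then show ?thesis by simp
qed

lemma Im_cinner: "Im (cinner x y) = inner x (\<i> *\<^sub>C (y::'a::complex_inner))"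
  by (simp add: inner_eq_Re_cinner cinner_scaleC_right)

lemma cinner_eq_inner: "cinner x y = Complex (inner x y) (inner x (\<i> *\<^sub>C (y::'a::complex_inner)))"
  by (simp add: complex_eq_iff Im_cinner inner_eq_Re_cinner)

text \<open>The real identity tested at \<open>\<i> *\<^sub>C x\<close> is the identity of imaginary
  parts at \<open>x\<close>. This lifts results of the real Riesz argument to the complex inner
  product.\<close>

lemma cinner_complex_eqI:
  fixes s t :: "'a::complex_inner \<Rightarrow> 'b::complex_inner"
  assumes "\<And>x. inner (t x) y = inner x z" "\<And>x. t (\<i> *\<^sub>C x) = \<i> *\<^sub>C t x"
  shows "cinner (t x) y = cinner x z"
proof -
  have "inner (t (\<i> *\<^sub>C x)) y = inner (\<i> *\<^sub>C x) z" by (rule assms)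
  then have "Im (cinner (t x) y) = Im (cinner x z)"
    by (simp add: assms(2) inner_eq_Re_cinner cinner_scaleC_left)
  then show ?thesis using assms(1)[of x] by (simp add: complex_eq_iff inner_eq_Re_cinner)
qed

lemma bounded_linear_scaleC: "bounded_linear (\<lambda>x::'a::complex_inner. c *\<^sub>C x)"
proof (rule bounded_linear_intro)
  show "c *\<^sub>C (x + y) = c *\<^sub>C x + c *\<^sub>C (y::'a)" for x y by (rule scaleC_add_right)
  show "c *\<^sub>C (r *\<^sub>R x) = r *\<^sub>R c *\<^sub>C (x::'a)" for r x
    by (simp add: scaleR_scaleC scaleC_scaleC mult.commute)
  show "norm (c *\<^sub>C x) \<le> norm (x::'a) * norm c" for x by (simp add: norm_scaleC)
qed

lemma continuous_cinner [continuous_intros]: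
  fixes f g :: "'b::topological_space \<Rightarrow> 'a::complex_inner"
  assumes "continuous_on S f" "continuous_on S g"
  shows "continuous_on S (\<lambda>x. cinner (f x) (g x))"
proof -
  have "continuous_on S (\<lambda>x. \<i> *\<^sub>C g x)"
    using bounded_linear.continuous_on[OF bounded_linear_scaleC assms(2)] .
  then show ?thesis unfolding cinner_eq_inner Complex_eq
    using assms by (intro continuous_intros) auto
qed

lemma continuous_scaleC [continuous_intros]:
  fixes f :: "'b::topological_space \<Rightarrow> 'a::complex_inner"
  assumes "continuous_on S f"
  shows "continuous_on S (\<lambda>x. c *\<^sub>C f x)"
  using bounded_linear.continuous_on[OF bounded_linear_scaleC assms] .

lemma bounded_clinearD:
  assumes "bounded_clinear t"
  shows "bounded_linear t" "t (x + y) = t x + t y" "t (c *\<^sub>C x) = c *\<^sub>C t x" "t 0 = 0"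
    "t (x - y) = t x - t y" "continuous_on S t"
  using assms linear_simps[of t] unfolding bounded_clinear_def
  by (auto intro: linear_continuous_on)

section \<open>Closed complex subspaces and orthogonality\<close>

lemma csubspace_imp_subspace: "complex_vector.subspace W \<Longrightarrow> subspace W"
  unfolding complex_vector.subspace_def subspace_def by (simp add: scaleR_scaleC)

lemma closed_orthogonal: "closed {v::'a::complex_inner. cinner v x = 0}"
  by (intro closed_Collect_eq continuous_intros)

lemma csubspace_orthogonal: "complex_vector.subspace {v::'a::complex_inner. cinner v x = 0}"
  by (auto simp: complex_vector.subspace_def cinner_add_left cinner_scaleC_left)

text \<open>Serves as an induction principle: a closed linear condition need only be checked on
  generators.\<close>

lemma closure_cspan_induct:
  assumes "v \<in> closure (cspan B)" "B \<subseteq> W" "complex_vector.subspace W" "closed W"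
  shows "v \<in> W"
  using assms by (meson closure_minimal complex_vector.span_minimal subsetD)

lemma csubspace_closure:
  assumes "complex_vector.subspace (W::'a::complex_inner set)"
  shows "complex_vector.subspace (closure W)"
proof (rule complex_vector.subspaceI)
  show "0 \<in> closure W" using assms closure_subset complex_vector.subspace_0 by blast
  have "(\<lambda>x. x + y) ` closure W \<subseteq> closure W" if "y \<in> W" for y
    using assms closure_subset[of W] that
    by (intro image_closure_subset continuous_intros) (auto simp: complex_vector.subspace_add)
  then have "(\<lambda>y. x + y) ` closure W \<subseteq> closure W" if "x \<in> closure W" for x
    using that by (intro image_closure_subset continuous_intros) auto
  then show "x + y \<in> closure W" if "x \<in> closure W" "y \<in> closure W" for x y
    using that by blast
  show "c *\<^sub>C x \<in> closure W" if "x \<in> closure W" for c x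
  proof -
    have "(\<lambda>x. c *\<^sub>C x) ` closure W \<subseteq> closure W"
      using assms closure_subset[of W]
      by (intro image_closure_subset continuous_intros)
        (auto simp: complex_vector.subspace_scale)
    then show ?thesis using that by blast
  qed
qed

lemma csubspace_closure_cspan: "complex_vector.subspace (closure (cspan B))"
  by (simp add: csubspace_closure complex_vector.subspace_span)

lemma orthogonal_closure_cspan:
  assumes "v \<in> closure (cspan B)" "\<And>b. b \<in> B \<Longrightarrow> cinner b x = 0"
  shows "cinner v x = 0"
  using closure_cspan_induct[OF assms(1) _ csubspace_orthogonal closed_orthogonal, of x] assms(2)
  by blast

text \<open>Riesz represents \<open>inner v\<close> on \<open>W\<close> by some \<open>w\<close>,
  which gives real orthogonality of \<open>v - w\<close>; as \<open>W\<close> is stable under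
  multiplication by \<open>\<i>\<close>, the imaginary part vanishes too.\<close>

lemma orthogonal_decomposition:
  fixes v :: "'a::chilbert_space"
  assumes W: "complex_vector.subspace W" "closed W"
  obtains w where "w \<in> W" "\<And>h. h \<in> W \<Longrightarrow> cinner h (v - w) = 0"
proof -
  obtain w where w: "w \<in> W" "\<And>h. h \<in> W \<Longrightarrow> inner v h = inner w h"
    using riesz_on_subspace[OF csubspace_imp_subspace[OF W(1)] W(2)
        bounded_linear_inner_right[of v]] by blast
  have "cinner (v - w) h = 0" if h: "h \<in> W" for h
  proof -
    have "\<i> *\<^sub>C h \<in> W" using W h complex_vector.subspace_scale by blast
    then show ?thesis using w(2)[OF h] w(2)[of "\<i> *\<^sub>C h"]
      by (simp add: cinner_eq_inner inner_diff_left complex_eq_iff)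
  qed
  then show thesis using w(1) that by (metis cinner_commute_eq_0)
qed

section \<open>Adjoints\<close>

lemma cadjoint_unique:
  fixes s t :: "'a::complex_inner \<Rightarrow> 'a"
  assumes "\<And>x y. cinner (t x) y = cinner x (s y)"
  shows "cadjoint t = s"
  unfolding cadjoint_def
proof (rule the_equality)
  show "\<forall>x y. cinner (t x) y = cinner x (s y)" using assms by blast
next
  fix r assume r: "\<forall>x y. cinner (t x) y = cinner x (r y)"
  have "r y = s y" for y
  proof -
    have "cinner x (r y - s y) = 0" for x using r assms by (simp add: cinner_diff_right)
    then show ?thesis by (metis cinner_self_eq_0 eq_iff_diff_eq_0)
  qed
  then show "r = s" by blast
qed

lemma cinner_cadjoint:
  fixes t :: "'a::chilbert_space \<Rightarrow> 'a"
  assumes "bounded_clinear t"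
  shows "cinner (t x) y = cinner x (cadjoint t y)"
proof -
  have "\<exists>z. \<forall>x. cinner (t x) y = cinner x z" for y
  proof -
    \<comment> \<open>Riesz on the whole space yields only a real adjoint; complex linearity of
      \<open>t\<close> then supplies the imaginary part.\<close>
    have "bounded_linear (\<lambda>x. inner (t x) y)"
      using bounded_linear_compose[OF bounded_linear_inner_left bounded_clinearD(1)[OF assms]] .
    then obtain z where "\<And>x. inner (t x) y = inner z x"
      using riesz_on_subspace[of UNIV "\<lambda>x. inner (t x) y"] by auto
    then show ?thesis using cinner_complex_eqI[of t y z] bounded_clinearD(3)[OF assms]
      by (metis inner_commute)
  qed
  then obtain s where s: "\<And>x y. cinner (t x) y = cinner x (s y)" by metis
  then show ?thesis using cadjoint_unique[OF s] by simp
qed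

lemma cinner_cadjoint':
  fixes t :: "'a::chilbert_space \<Rightarrow> 'a"
  assumes "bounded_clinear t"
  shows "cinner (cadjoint t x) y = cinner x (t y)"
  by (metis cinner_cadjoint[OF assms] cinner_commute)

lemma bounded_clinear_comp:
  "bounded_clinear s \<Longrightarrow> bounded_clinear t \<Longrightarrow> bounded_clinear (s \<circ> t)"
  unfolding bounded_clinear_def by (auto simp: o_def intro: bounded_linear_compose)

lemma bounded_clinear_id: "bounded_clinear id"
  unfolding bounded_clinear_def by (simp add: id_def)

subsection \<open>Unitaries\<close>

text \<open>An inverse of a map preserving inner products satisfies the defining identity of the
  adjoint, so the adjoint is identified rather than constructed.\<close>

lemma unitaryI:
  assumes t: "bounded_clinear t" and "s \<circ> t = id" "t \<circ> s = id"
    and inner: "\<And>x y. cinner (t x) (t y) = cinner x y"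
  shows "unitary t" "cadjoint t = s"
proof -
  have ts: "t (s y) = y" for y using assms(3) by (metis comp_apply id_apply)
  show adj: "cadjoint t = s"
    by (rule cadjoint_unique) (metis inner ts)
  show "unitary t" unfolding unitary_def adj using assms by blast
qed

lemma unitary_id: "unitary id"
  using unitaryI(1)[of id id] bounded_clinear_id by auto

context
  fixes u :: "'a::chilbert_space \<Rightarrow> 'a"
  assumes u: "unitary u"
begin

lemma unitary_clinear: "bounded_clinear u"
  using u by (simp add: unitary_def)

lemma unitary_adj_apply [simp]: "cadjoint u (u x) = x" "u (cadjoint u x) = x"
  using u unfolding unitary_def by (metis comp_apply id_apply)+

lemma unitary_cinner: "cinner (u x) (u y) = cinner x y"
  by (simp add: cinner_cadjoint unitary_clinear)

text \<open>\<open>u\<close> is linear and injective, so linearity of its inverse can be checked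
  after applying \<open>u\<close>; boundedness follows from isometry.\<close>

lemma unitary_cadjoint: "unitary (cadjoint u)"
proof -
  have inj: "x = y" if "u x = u y" for x y using that unitary_adj_apply(1) by metis
  note lin = bounded_clinearD[OF unitary_clinear]
  have cin: "cinner (cadjoint u x) (cadjoint u y) = cinner x y" for x y
    using unitary_cinner[of "cadjoint u x" "cadjoint u y"] by simp
  have "bounded_clinear (cadjoint u)"
    unfolding bounded_clinear_def
  proof (intro conjI allI bounded_linear_intro)
    show "cadjoint u (x + y) = cadjoint u x + cadjoint u y" for x y
      by (rule inj) (simp add: lin)
    show c: "cadjoint u (c *\<^sub>C x) = c *\<^sub>C cadjoint u x" for c x
      by (rule inj) (simp add: lin)
    show "cadjoint u (r *\<^sub>R x) = r *\<^sub>R cadjoint u x" for r x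
      by (simp add: scaleR_scaleC c)
    show "norm (cadjoint u x) \<le> norm x * 1" for x
      using cin[of x x] by (simp add: cinner_self flip: of_real_power)
  qed
  then show "unitary (cadjoint u)"
    using unitaryI(1)[of "cadjoint u" u] cin by (auto simp: fun_eq_iff)
qed

end

lemma unitary_comp:
  fixes u v :: "'a::chilbert_space \<Rightarrow> 'a"
  assumes "unitary u" "unitary v"
  shows "unitary (u \<circ> v)"
  using unitaryI(1)[of "u \<circ> v" "cadjoint v \<circ> cadjoint u"] assms
  by (auto simp: unitary_clinear bounded_clinear_comp unitary_cinner fun_eq_iff)

subsection \<open>Projections\<close>

lemma cinner_projection:
  fixes p :: "'a::chilbert_space \<Rightarrow> 'a"
  shows "is_projection p \<Longrightarrow> cinner (p x) y = cinner x (p y)"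
  using cinner_cadjoint unfolding is_projection_def by metis

lemma projection_idem: "is_projection p \<Longrightarrow> p (p x) = p x"
  unfolding is_projection_def by (metis comp_apply)

lemma projection_clinear: "is_projection p \<Longrightarrow> bounded_clinear p"
  unfolding is_projection_def by simp

lemma range_projection: "is_projection p \<Longrightarrow> range p = {x. p x = x}"
  using projection_idem by (auto simp: image_iff) metis

lemma closed_range_projection: "is_projection p \<Longrightarrow> closed (range p)"
  unfolding range_projection
  by (intro closed_Collect_eq continuous_intros) (auto intro: bounded_clinearD(6) projection_clinear)

lemma csubspace_range_projection: "is_projection p \<Longrightarrow> complex_vector.subspace (range p)"
  unfolding range_projection complex_vector.subspace_def
  by (auto simp: bounded_clinearD[OF projection_clinear])

subsection \<open>Orthonormal sets\<close>

definition orthonormal :: "'a::complex_inner set \<Rightarrow> bool" where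
  "orthonormal B \<longleftrightarrow> (\<forall>x\<in>B. \<forall>y\<in>B. cinner x y = (if x = y then 1 else 0))"

lemma orthonormal_basis_iff: "orthonormal_basis V B \<longleftrightarrow> orthonormal B \<and> closure (cspan B) = V"
  by (simp add: orthonormal_basis_def orthonormal_def)

lemma orthonormal_nonzero: "orthonormal B \<Longrightarrow> b \<in> B \<Longrightarrow> b \<noteq> 0"
  unfolding orthonormal_def by (metis cinner_zero_left zero_neq_one)

lemma orthonormal_subset: "orthonormal B \<Longrightarrow> C \<subseteq> B \<Longrightarrow> orthonormal C"
  unfolding orthonormal_def by blast

lemma cinner_orthonormal_sum:
  assumes "orthonormal F" "finite F" "b \<in> F"
  shows "cinner b (\<Sum>c\<in>F. a c *\<^sub>C c) = cnj (a b)"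
proof -
  have "cinner b (\<Sum>c\<in>F. a c *\<^sub>C c) = (\<Sum>c\<in>F. if c = b then cnj (a b) else 0)"
    using assms(1,3) unfolding cinner_sum_right orthonormal_def
    by (intro sum.cong) (auto simp: cinner_scaleC_right)
  then show ?thesis using assms by simp
qed

lemma orthonormal_independent:
  assumes "orthonormal B"
  shows "complex_vector.independent B"
  unfolding complex_vector.independent_explicit_module
proof (intro allI impI)
  fix F a v assume F: "finite F" "F \<subseteq> B" "(\<Sum>v\<in>F. a v *\<^sub>C v) = 0" "v \<in> F"
  show "a v = 0"
    using cinner_orthonormal_sum[of F v a] orthonormal_subset[OF assms] F by simp
qed

lemma bessel:
  assumes "orthonormal F" "finite F"
  shows "(\<Sum>b\<in>F. (cmod (cinner x b))\<^sup>2) \<le> (norm (x::'a::complex_inner))\<^sup>2"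
proof -
  \<comment> \<open>\<open>y\<close> is the orthogonal projection of \<open>x\<close> to the span of
    \<open>F\<close>; the inequality is the nonnegativity of the squared norm of
    \<open>x - y\<close>.\<close>
  define y where "y = (\<Sum>b\<in>F. cinner x b *\<^sub>C b)"
  have lin: "cinner y z = (\<Sum>b\<in>F. cinner x b * cinner b z)" for z
    by (simp add: y_def cinner_sum_left cinner_scaleC_left)
  have "cinner b y = cinner b x" if "b \<in> F" for b
    using cinner_orthonormal_sum[OF assms that, of "cinner x"] cinner_commute[of b x]
    unfolding y_def by simp
  then have yy: "cinner y y = cinner y x" by (simp add: lin)
  have "cinner y x = (\<Sum>b\<in>F. complex_of_real ((cmod (cinner x b))\<^sup>2))"
    unfolding lin by (intro sum.cong refl) (simp only: complex_norm_square cinner_commute[of _ x])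
  then have yx: "cinner y x = complex_of_real (\<Sum>b\<in>F. (cmod (cinner x b))\<^sup>2)"
    by simp
  then have "cinner x y = cinner y x" using cinner_commute[of x y] by simp
  then have "cinner (x - y) (x - y) = cinner x x - cinner y x"
    using yy by (simp add: cinner_diff_left cinner_diff_right)
  also have "\<dots> = complex_of_real ((norm x)\<^sup>2 - (\<Sum>b\<in>F. (cmod (cinner x b))\<^sup>2))"
    unfolding yx cinner_self by simp
  finally have "complex_of_real ((norm (x - y))\<^sup>2) = \<dots>" by (simp only: cinner_self)
  then have "(norm (x - y))\<^sup>2 = (norm x)\<^sup>2 - (\<Sum>b\<in>F. (cmod (cinner x b))\<^sup>2)"
    using of_real_eq_iff by blast
  then show ?thesis by (smt (verit) zero_le_power2)
qed

text \<open>By Bessel only finitely many coefficients exceed a given positive threshold; the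
  thresholds \<open>inverse (real (Suc n))\<close> exhaust the nonzero ones.\<close>

lemma countable_bessel:
  assumes "orthonormal S"
  shows "countable {s\<in>S. cinner (x::'a::complex_inner) s \<noteq> 0}"
proof -
  define T where "T n = {s\<in>S. cmod (cinner x s) \<ge> inverse (real (Suc n))}" for n
  have fin: "finite (T n)" for n
  proof (rule ccontr)
    assume inf: "infinite (T n)"
    define e where "e = (inverse (real (Suc n)))\<^sup>2"
    have e: "e > 0" by (simp add: e_def)
    obtain N where N: "(norm x)\<^sup>2 < real N * e" using reals_Archimedean3[OF e] by blast
    obtain F where F: "F \<subseteq> T n" "finite F" "card F = N"
      using infinite_arbitrarily_large[OF inf] by blast
    have "real N * e \<le> (\<Sum>s\<in>F. (cmod (cinner x s))\<^sup>2)"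
    proof -
      have "e \<le> (cmod (cinner x s))\<^sup>2" if "s \<in> F" for s
        unfolding e_def using that F(1) by (intro power_mono) (auto simp: T_def)
      then show ?thesis using sum_bounded_below[of F e "\<lambda>s. (cmod (cinner x s))\<^sup>2"] F(3) by simp
    qed
    also have "\<dots> \<le> (norm x)\<^sup>2"
      using F(1,2) by (intro bessel orthonormal_subset[OF assms]) (auto simp: T_def)
    finally show False using N by simp
  qed
  have "{s\<in>S. cinner x s \<noteq> 0} \<subseteq> (\<Union>n. T n)"
  proof
    fix s assume s: "s \<in> {s\<in>S. cinner x s \<noteq> 0}"
    then obtain n where "inverse (real (Suc n)) < cmod (cinner x s)"
      using reals_Archimedean[of "cmod (cinner x s)"] by auto
    then show "s \<in> (\<Union>n. T n)" using s unfolding T_def by (auto intro: less_imp_le)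
  qed
  moreover have "countable (\<Union>n. T n)" using fin by (simp add: countable_finite)
  ultimately show ?thesis using countable_subset by blast
qed

text \<open>For \<open>v\<close> in the closed span, \<open>v\<close> minus its finite expansion
  lies in the closed span and is orthogonal to \<open>B\<close>, hence to itself.\<close>

lemma closure_cspan_finite:
  assumes "orthonormal B" "finite B"
  shows "closure (cspan B) = cspan (B::'a::complex_inner set)"
proof (intro equalityI subsetI)
  fix v assume v: "v \<in> closure (cspan B)"
  define w where "w = (\<Sum>b\<in>B. cinner v b *\<^sub>C b)"
  have w: "w \<in> cspan B"
    unfolding w_def
    by (intro complex_vector.span_sum complex_vector.span_scale complex_vector.span_base)
  have "cinner b (v - w) = 0" if "b \<in> B" for b
    using cinner_orthonormal_sum[OF assms that, of "cinner v"] cinner_commute[of b v]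
    unfolding w_def cinner_diff_right by simp
  moreover have "v - w \<in> closure (cspan B)"
    using v w closure_subset[of "cspan B"]
    by (intro complex_vector.subspace_diff[OF csubspace_closure_cspan]) auto
  ultimately have "cinner (v - w) (v - w) = 0" by (rule orthogonal_closure_cspan[rotated])
  then show "v \<in> cspan B" using w by simp
next
  show "v \<in> closure (cspan B)" if "v \<in> cspan B" for v
    using that closure_subset[of "cspan B"] by auto
qed

text \<open>Makes ranks comparable although \<open>projection_rank\<close> rests on an arbitrary
  choice of basis. For finite \<open>B\<close> this is linear independence. For infinite
  \<open>B\<close>, each \<open>s\<close> has a nonzero coefficient at some \<open>b\<close>, while
  each \<open>b\<close> sees only countably many \<open>s\<close>, and countable multiples do not
  enlarge an infinite \<open>|B|\<close>.\<close>

lemma card_orthonormal_le: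
  fixes B S :: "'a::complex_inner set"
  assumes B: "orthonormal B" and S: "orthonormal S" "S \<subseteq> closure (cspan B)"
  shows "|S| \<le>o |B|"
proof (cases "finite B")
  case True
  then have "finite S \<and> card S \<le> card B"
    using complex_vector.independent_span_bound[OF True orthonormal_independent[OF S(1)]] S(2)
      closure_cspan_finite[OF B True] by simp
  then show ?thesis using True inj_on_iff_card_le[of S B] card_of_ordLeq[of S B] by blast
next
  case False
  have "S \<subseteq> (\<Union>b\<in>B. {s\<in>S. cinner b s \<noteq> 0})"
  proof
    fix s assume s: "s \<in> S"
    have "\<exists>b\<in>B. cinner b s \<noteq> 0"
    proof (rule ccontr)
      assume "\<not> ?thesis"
      then have "cinner s s = 0" using orthogonal_closure_cspan S(2) s by blast
      then show False using orthonormal_nonzero[OF S(1) s] by simp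
    qed
    then show "s \<in> (\<Union>b\<in>B. {s\<in>S. cinner b s \<noteq> 0})" using s by blast
  qed
  moreover have "|\<Union>b\<in>B. {s\<in>S. cinner b s \<noteq> 0}| \<le>o |B|"
  proof (rule card_of_UNION_ordLeq_infinite[OF False])
    show "\<forall>b\<in>B. |{s\<in>S. cinner b s \<noteq> 0}| \<le>o |B|"
    proof
      fix b assume "b \<in> B"
      have "|{s\<in>S. cinner b s \<noteq> 0}| \<le>o |UNIV::nat set|"
        using countable_bessel[OF S(1)] unfolding countable_def card_of_ordLeq[symmetric] by blast
      also have "|UNIV::nat set| \<le>o |B|" using False infinite_iff_card_of_nat by blast
      finally show "|{s\<in>S. cinner b s \<noteq> 0}| \<le>o |B|" .
    qed
  qed (simp add: card_of_mono1)
  ultimately show ?thesis by (rule ordLeq_transitive[OF card_of_mono1])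
qed

lemma orthonormal_basis_exists:
  fixes V :: "'a::chilbert_space set"
  assumes V: "complex_vector.subspace V" "closed V"
  shows "\<exists>B. orthonormal_basis V B"
proof -
  define \<B> where "\<B> = {B. B \<subseteq> V \<and> orthonormal B}"
  have chain: "\<Union>C \<in> \<B>" if "subset.chain \<B> C" for C
  proof -
    have "orthonormal (\<Union>C)"
      unfolding orthonormal_def
    proof (intro ballI)
      fix x y assume "x \<in> \<Union>C" "y \<in> \<Union>C"
      then obtain D1 D2 where D12: "D1 \<in> C" "x \<in> D1" "D2 \<in> C" "y \<in> D2" by blast
      moreover have "D1 \<subseteq> D2 \<or> D2 \<subseteq> D1"
        using that D12(1,3) unfolding subset_chain_def by blast
      ultimately obtain D where D: "D \<in> C" "x \<in> D" "y \<in> D" by blast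
      then have "D \<in> \<B>" using that unfolding subset_chain_def by blast
      then have "orthonormal D" by (simp add: \<B>_def)
      then show "cinner x y = (if x = y then 1 else 0)" using D unfolding orthonormal_def by blast
    qed
    moreover have "C \<subseteq> \<B>" using that by (simp add: subset_chain_def)
    ultimately show ?thesis by (auto simp: \<B>_def)
  qed
  then obtain B where B: "B \<in> \<B>" "\<And>C. C \<in> \<B> \<Longrightarrow> B \<subseteq> C \<Longrightarrow> C = B"
    using subset_Zorn'[of \<B>, OF chain] by blast
  have BV: "B \<subseteq> V" "orthonormal B" using B(1) by (auto simp: \<B>_def)
  have sub: "closure (cspan B) \<subseteq> V"
    using closure_cspan_induct[OF _ BV(1) V] by blast
  have "V \<subseteq> closure (cspan B)"
  proof (rule ccontr)
    assume "\<not> ?thesis"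
    then obtain v where v: "v \<in> V" "v \<notin> closure (cspan B)" by blast
    obtain w where w: "w \<in> closure (cspan B)" "\<And>h. h \<in> closure (cspan B) \<Longrightarrow> cinner h (v - w) = 0"
      using orthogonal_decomposition[OF csubspace_closure_cspan closed_closure] by blast
    define d where "d = v - w"
    have d: "d \<noteq> 0" "d \<in> V"
      using v w(1) sub complex_vector.subspace_diff[OF V(1)] unfolding d_def by auto
    \<comment> \<open>The normalised component of \<open>v\<close> orthogonal to the closed span
      could be added to \<open>B\<close>, against maximality.\<close>
    define e where "e = complex_of_real (inverse (norm d)) *\<^sub>C d"
    have "norm e = 1" using d(1) by (simp add: e_def norm_scaleC norm_inverse)
    then have e1: "cinner e e = 1" by (simp add: cinner_self)
    have "b \<in> closure (cspan B)" if "b \<in> B" for b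
      using that closure_subset complex_vector.span_base by blast
    then have e0: "cinner b e = 0" if "b \<in> B" for b
      using w(2)[of b] that by (simp add: e_def d_def cinner_scaleC_right)
    then have "e \<notin> B" using e1 by force
    moreover have "insert e B \<in> \<B>"
    proof -
      have "e \<in> V" using d(2) V(1) complex_vector.subspace_scale unfolding e_def by blast
      moreover have "cinner e b = 0" if "b \<in> B" for b using e0[OF that] cinner_commute_eq_0 by blast
      ultimately show ?thesis using BV e0 e1 unfolding \<B>_def orthonormal_def by auto
    qed
    ultimately show False using B(2) by blast
  qed
  then show ?thesis using sub BV(2) unfolding orthonormal_basis_iff by blast
qed

section \<open>Operators defined by permuting an orthonormal basis\<close>

interpretation complex_vector_pair:
  vector_space_pair "scaleC :: complex \<Rightarrow> 'a \<Rightarrow> 'a::complex_inner" "scaleC :: complex \<Rightarrow> 'b \<Rightarrow> 'b::complex_inner"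
  by unfold_locales

text \<open>The linear extension of \<open>\<beta>\<close> is isometric on the algebraic span, hence
  uniformly continuous there, and so extends to the closure.\<close>

lemma orthonormal_bij_isometry:
  fixes B :: "'a::chilbert_space set"
  assumes B: "orthonormal B" "closure (cspan B) = UNIV" and \<beta>: "inj_on \<beta> B" "\<beta> ` B \<subseteq> B"
  obtains u where "bounded_clinear u" "\<And>x y. cinner (u x) (u y) = cinner x y"
    "\<And>b. b \<in> B \<Longrightarrow> u b = \<beta> b"
proof -
  \<comment> \<open>\<open>g\<close> is linear on the whole space but uncontrolled outside
    \<open>cspan B\<close>; only its values on that span are kept.\<close>
  obtain g where g: "Vector_Spaces.linear scaleC scaleC g" "\<And>b. b \<in> B \<Longrightarrow> g b = \<beta> b"
    using complex_vector_pair.linear_independent_extend[OF orthonormal_independent[OF B(1)], of \<beta>]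
    by blast
  interpret g: Vector_Spaces.linear scaleC scaleC g by fact
  have iso1: "cinner (g b) (g y) = cinner b y" if b: "b \<in> B" and y: "y \<in> cspan B" for b y
    using y
  proof (induction rule: complex_vector.span_induct_alt)
    case base then show ?case by (simp add: g.zero)
  next
    case (step c a y)
    have "cinner (g b) (g a) = cinner b a"
      using b step(1) B(1) \<beta> g(2) unfolding orthonormal_def
      by (smt (verit) image_subset_iff inj_onD)
    then show ?case using step by (simp add: g.add g.scale cinner_add_right cinner_scaleC_right)
  qed
  have iso: "cinner (g x) (g y) = cinner x y" if x: "x \<in> cspan B" and y: "y \<in> cspan B" for x y
    using x
  proof (induction rule: complex_vector.span_induct_alt)
    case base then show ?case by (simp add: g.zero)
  next
    case (step c a z)
    then show ?case using iso1[OF step(1) y] by (simp add: g.add g.scale cinner_add_left cinner_scaleC_left)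
  qed
  have "dist (g x) (g y) = dist x y" if "x \<in> cspan B" "y \<in> cspan B" for x y
  proof -
    have "x - y \<in> cspan B" using that complex_vector.span_diff by blast
    then show ?thesis using iso[of "x - y" "x - y"]
      by (simp add: cinner_self dist_norm g.diff flip: of_real_power)
  qed
  then have "uniformly_continuous_on (cspan B) g"
    unfolding uniformly_continuous_on_def by auto
  then obtain u where u: "uniformly_continuous_on UNIV u" "\<And>x. x \<in> cspan B \<Longrightarrow> g x = u x"
    by (rule uniformly_continuous_on_extension_on_closure) (use B(2) in auto)
  have cont: "continuous_on S u" for S
    using uniformly_continuous_imp_continuous[OF u(1)] continuous_on_subset by blast
  have cont': "continuous_on UNIV (\<lambda>x. u (f x))" if "continuous_on UNIV f" for f
    using that continuous_on_compose2[OF cont] by blast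
  \<comment> \<open>Identities pass from the dense span to the whole space as closed conditions;
    \<open>ext2\<close> does so in one variable at a time.\<close>
  have ext: "Q x" if "closed {x. Q x}" "\<And>x. x \<in> cspan B \<Longrightarrow> Q x" for Q :: "'a \<Rightarrow> bool" and x
    using closure_minimal[of "cspan B" "{x. Q x}"] that B(2) by blast
  have ext2: "Q x y" if "\<And>y. closed {x. Q x y}" "\<And>x. closed {y. Q x y}"
    "\<And>x y. x \<in> cspan B \<Longrightarrow> y \<in> cspan B \<Longrightarrow> Q x y" for Q :: "'a \<Rightarrow> 'a \<Rightarrow> bool" and x y
    using ext[of "\<lambda>x. Q x y"] ext[of "\<lambda>y. Q _ y"] that by blast
  note ci = closed_Collect_eq continuous_intros cont'
  have inner: "cinner (u x) (u y) = cinner x y" for x y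
    by (rule ext2) (auto intro!: ci simp: iso simp flip: u(2))
  have scale: "u (c *\<^sub>C x) = c *\<^sub>C u x" for c x
    by (rule ext[of "\<lambda>x. u (c *\<^sub>C x) = c *\<^sub>C u x"])
      (auto intro!: ci simp: complex_vector.span_scale g.scale simp flip: u(2))
  have "bounded_clinear u"
    unfolding bounded_clinear_def
  proof (intro conjI allI bounded_linear_intro)
    show "u (x + y) = u x + u y" for x y
      by (rule ext2) (auto intro!: ci simp: complex_vector.span_add g.add simp flip: u(2))
    show "u (r *\<^sub>R x) = r *\<^sub>R u x" for r x by (simp add: scaleR_scaleC scale)
    show "norm (u x) \<le> norm x * 1" for x
      using inner[of x x] by (simp add: cinner_self flip: of_real_power)
  qed (rule scale)
  moreover have "u b = \<beta> b" if "b \<in> B" for b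
    using g(2)[OF that] u(2)[OF complex_vector.span_base[OF that]] by simp
  ultimately show thesis using that inner by blast
qed

lemma bounded_clinear_eqI:
  fixes B :: "'a::complex_inner set"
  assumes "closure (cspan B) = UNIV" "bounded_clinear s" "bounded_clinear t" "\<And>b. b \<in> B \<Longrightarrow> s b = t b"
  shows "s = t"
proof
  fix x
  have "x \<in> {x. s x = t x}"
    by (rule closure_cspan_induct[of x B])
      (use assms in \<open>auto simp: complex_vector.subspace_def bounded_clinearD
        intro!: closed_Collect_eq bounded_clinearD(6)\<close>)
  then show "s x = t x" by simp
qed

text \<open>The isometries induced by \<open>\<beta>\<close> and by its inverse compose to the
  identity on the basis, hence everywhere. So the adjoint permutes the basis by the inverse, which
  makes its support accessible too.\<close>

lemma orthonormal_bij_unitary: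
  fixes B :: "'a::chilbert_space set"
  assumes B: "orthonormal B" "closure (cspan B) = UNIV" and \<beta>: "bij_betw \<beta> B B"
  obtains u where "unitary u" "\<And>b. b \<in> B \<Longrightarrow> u b = \<beta> b"
    "\<And>b. b \<in> B \<Longrightarrow> cadjoint u b = inv_into B \<beta> b"
proof -
  let ?\<gamma> = "inv_into B \<beta>"
  have \<gamma>: "bij_betw ?\<gamma> B B" using \<beta> by (rule bij_betw_inv_into)
  obtain u where u: "bounded_clinear u" "\<And>x y. cinner (u x) (u y) = cinner x y"
    "\<And>b. b \<in> B \<Longrightarrow> u b = \<beta> b"
    using orthonormal_bij_isometry[OF B bij_betw_imp_inj_on[OF \<beta>]] bij_betw_imp_surj_on[OF \<beta>] by blast
  obtain v where "bounded_clinear v \<and> (\<forall>b\<in>B. v b = ?\<gamma> b)"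
    using orthonormal_bij_isometry[OF B bij_betw_imp_inj_on[OF \<gamma>]] bij_betw_imp_surj_on[OF \<gamma>]
    by (metis order_refl)
  then have v: "bounded_clinear v" "\<And>b. b \<in> B \<Longrightarrow> v b = ?\<gamma> b" by auto
  have "v \<circ> u = id" "u \<circ> v = id"
    by (rule bounded_clinear_eqI[OF B(2)],
        use u v bij_betw_apply[OF \<beta>] bij_betw_apply[OF \<gamma>] bij_betw_inv_into_left[OF \<beta>]
          bij_betw_inv_into_right[OF \<beta>] in
          \<open>auto simp: bounded_clinear_comp bounded_clinear_id\<close>)+
  then have "unitary u" "cadjoint u = v" using unitaryI[OF u(1)] u(2) by blast+
  then show thesis using that u(3) v(2) by blast
qed

section \<open>Coarse maps and coarse equivalences\<close>

text \<open>The free index type lets one notion compare functions on \<open>X\<close>, the two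
  projections of a relation, and locations of basis vectors.\<close>

definition close :: "('a \<times> 'a) set set \<Rightarrow> 'i set \<Rightarrow> ('i \<Rightarrow> 'a) \<Rightarrow> ('i \<Rightarrow> 'a) \<Rightarrow> bool" where
  "close \<E> I p q \<longleftrightarrow> (\<lambda>i. (p i, q i)) ` I \<in> \<E>"

definition graph :: "'a set \<Rightarrow> ('a \<Rightarrow> 'a) \<Rightarrow> ('a \<times> 'a) set" where
  "graph X f = {(f x, x) | x. x \<in> X}"

locale coarse =
  fixes X :: "'a set" and \<E> :: "('a \<times> 'a) set set"
  assumes coarse_space: "coarse_space X \<E>"
begin

lemma ent_subset: "E \<in> \<E> \<Longrightarrow> F \<subseteq> E \<Longrightarrow> F \<in> \<E>"
  and ent_Un: "E \<in> \<E> \<Longrightarrow> F \<in> \<E> \<Longrightarrow> E \<union> F \<in> \<E>"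
  and ent_Id: "Id_on X \<in> \<E>"
  and ent_converse: "E \<in> \<E> \<Longrightarrow> E\<inverse> \<in> \<E>"
  and ent_comp: "E \<in> \<E> \<Longrightarrow> F \<in> \<E> \<Longrightarrow> E O F \<in> \<E>"
  and ent_space: "E \<in> \<E> \<Longrightarrow> E \<subseteq> X \<times> X"
  using coarse_space unfolding coarse_space_def by (simp, blast?)+

section \<open>Closeness of maps, and the coarse order on relations\<close>

lemma closeI: "E \<in> \<E> \<Longrightarrow> (\<And>i. i \<in> I \<Longrightarrow> (p i, q i) \<in> E) \<Longrightarrow> close \<E> I p q"
  unfolding close_def by (rule ent_subset) auto

lemma closeE:
  assumes "close \<E> I p q"
  obtains E where "E \<in> \<E>" "\<And>i. i \<in> I \<Longrightarrow> (p i, q i) \<in> E"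
  using assms that unfolding close_def by blast

lemma closeD: "close \<E> I p q \<Longrightarrow> \<exists>E\<in>\<E>. \<forall>i\<in>I. (p i, q i) \<in> E"
  by (erule closeE) blast

lemma close_refl: "p \<in> I \<rightarrow> X \<Longrightarrow> close \<E> I p p"
  by (rule closeI[OF ent_Id]) auto

lemma close_sym: "close \<E> I p q \<Longrightarrow> close \<E> I q p"
  by (elim closeE) (rule closeI[OF ent_converse], auto)

lemma close_trans: "close \<E> I p q \<Longrightarrow> close \<E> I q r \<Longrightarrow> close \<E> I p r"
  by (elim closeE) (blast intro: closeI[OF ent_comp])

lemma close_reindex: "close \<E> I p q \<Longrightarrow> h \<in> J \<rightarrow> I \<Longrightarrow> close \<E> J (p \<circ> h) (q \<circ> h)"
  by (elim closeE) (erule closeI, auto)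

lemma coarse_le_refl: "R \<subseteq> X \<times> X \<Longrightarrow> coarse_le \<E> R R"
  unfolding coarse_le_def by (intro bexI[of _ "Id_on X"] ent_Id) auto

lemma coarse_le_subset: "R \<subseteq> S \<Longrightarrow> S \<subseteq> X \<times> X \<Longrightarrow> coarse_le \<E> R S"
  using coarse_le_refl[of S] unfolding coarse_le_def by blast

lemma coarse_le_trans:
  assumes "coarse_le \<E> R S" "coarse_le \<E> S T"
  shows "coarse_le \<E> R T"
proof -
  obtain E F E' F' where *: "E \<in> \<E>" "F \<in> \<E>" "R \<subseteq> F O S O E" "E' \<in> \<E>" "F' \<in> \<E>" "S \<subseteq> F' O T O E'"
    using assms unfolding coarse_le_def by auto
  then have "R \<subseteq> (F O F') O T O (E' O E)" by blast
  then show ?thesis unfolding coarse_le_def using * ent_comp by blast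
qed

lemma coarse_class_eq_iff:
  assumes "R \<subseteq> X \<times> X" "S \<subseteq> X \<times> X"
  shows "coarse_class X \<E> R = coarse_class X \<E> S \<longleftrightarrow> coarse_le \<E> R S \<and> coarse_le \<E> S R"
proof
  assume "coarse_class X \<E> R = coarse_class X \<E> S"
  moreover have "R \<in> coarse_class X \<E> R" using assms coarse_le_refl by (simp add: coarse_class_def)
  ultimately show "coarse_le \<E> R S \<and> coarse_le \<E> S R" by (simp add: coarse_class_def)
next
  assume "coarse_le \<E> R S \<and> coarse_le \<E> S R"
  then show "coarse_class X \<E> R = coarse_class X \<E> S"
    unfolding coarse_class_def by (auto intro: coarse_le_trans)
qed

text \<open>The inner entourage is absorbed into the entourage being tested, the outer one into the
  result.\<close>

lemma controlled_rel_le: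
  assumes "controlled_rel \<E> S" "coarse_le \<E> R S"
  shows "controlled_rel \<E> R"
  unfolding controlled_rel_def
proof
  fix G assume G: "G \<in> \<E>"
  obtain E F where EF: "E \<in> \<E>" "F \<in> \<E>" "R \<subseteq> F O S O E"
    using assms(2) unfolding coarse_le_def by auto
  have "S O (E O G O E\<inverse>) O S\<inverse> \<in> \<E>"
    using assms(1) EF G unfolding controlled_rel_def by (simp add: ent_comp ent_converse)
  then have "F O (S O (E O G O E\<inverse>) O S\<inverse>) O F\<inverse> \<in> \<E>"
    using EF by (simp add: ent_comp ent_converse)
  moreover have "R O G O R\<inverse> \<subseteq> F O (S O (E O G O E\<inverse>) O S\<inverse>) O F\<inverse>"
  proof -
    have "R O G O R\<inverse> \<subseteq> (F O S O E) O G O (F O S O E)\<inverse>" using EF(3)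
      by (intro relcomp_mono converse_mono[THEN iffD2]) auto
    also have "\<dots> = F O (S O (E O G O E\<inverse>) O S\<inverse>) O F\<inverse>" by (simp add: converse_relcomp O_assoc)
    finally show ?thesis .
  qed
  ultimately show "R O G O R\<inverse> \<in> \<E>" by (rule ent_subset)
qed

text \<open>The definition asks for some controlled representative; control passes down the coarse
  order, so any representative can be tested.\<close>

lemma partial_coarse_map_class_iff:
  assumes "R \<subseteq> X \<times> X"
  shows "partial_coarse_map X \<E> (coarse_class X \<E> R) \<longleftrightarrow> controlled_rel \<E> R"
  unfolding partial_coarse_map_def using assms coarse_class_eq_iff controlled_rel_le by metis

lemma controlled_rel_comp:
  assumes "controlled_rel \<E> R" "controlled_rel \<E> S"
  shows "controlled_rel \<E> (R O S)"
  unfolding controlled_rel_def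
proof
  fix G assume "G \<in> \<E>"
  then have "R O (S O G O S\<inverse>) O R\<inverse> \<in> \<E>" using assms unfolding controlled_rel_def by blast
  then show "(R O S) O G O (R O S)\<inverse> \<in> \<E>" by (simp add: converse_relcomp O_assoc)
qed

section \<open>Controlled functions as representatives of coarse maps\<close>

definition cmap :: "('a \<Rightarrow> 'a) \<Rightarrow> bool" where
  "cmap f \<longleftrightarrow> f \<in> X \<rightarrow> X \<and> (\<forall>E\<in>\<E>. map_prod f f ` E \<in> \<E>)"

lemma cmap_space: "cmap f \<Longrightarrow> f \<in> X \<rightarrow> X"
  by (simp add: cmap_def)

lemma cmap_close:
  assumes "cmap f" "close \<E> I p q"
  shows "close \<E> I (f \<circ> p) (f \<circ> q)"
  using assms(2)
proof (rule closeE)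
  fix E assume "E \<in> \<E>" "\<And>i. i \<in> I \<Longrightarrow> (p i, q i) \<in> E"
  then show ?thesis using assms(1) by (intro closeI[of "map_prod f f ` E"]) (auto simp: cmap_def)
qed

lemma cmap_id: "cmap id"
  by (simp add: cmap_def map_prod.id)

lemma cmap_comp: "cmap f \<Longrightarrow> cmap g \<Longrightarrow> cmap (f \<circ> g)"
  by (auto simp: cmap_def map_prod.comp[symmetric] image_comp[symmetric] simp del: o_apply)
    (auto simp: Pi_iff)

lemma graph_space: "f \<in> X \<rightarrow> X \<Longrightarrow> graph X f \<subseteq> X \<times> X"
  by (auto simp: graph_def)

lemma fun_class_graph: "fun_class X \<E> f = coarse_class X \<E> (graph X f)"
  by (simp add: fun_class_def graph_def)

text \<open>A controlled \<open>f\<close> carries the inner entourage to an entourage on the target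
  side, so the two-sided thickening of the graph collapses to a pointwise estimate.\<close>

lemma coarse_le_graph_iff:
  assumes "cmap f" "R \<subseteq> X \<times> X"
  shows "coarse_le \<E> R (graph X f) \<longleftrightarrow> close \<E> R fst (f \<circ> snd)"
proof
  assume "coarse_le \<E> R (graph X f)"
  then obtain E F where EF: "E \<in> \<E>" "F \<in> \<E>" "R \<subseteq> F O graph X f O E"
    unfolding coarse_le_def by auto
  have "F O map_prod f f ` E \<in> \<E>" using EF assms(1) by (simp add: ent_comp cmap_def)
  then show "close \<E> R fst (f \<circ> snd)"
  proof (rule closeI)
    fix i assume "i \<in> R"
    moreover obtain y x where i: "i = (y, x)" by fastforce
    ultimately obtain z where "(y, f z) \<in> F" "(z, x) \<in> E" using EF(3) by (auto simp: graph_def)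
    then show "(fst i, (f \<circ> snd) i) \<in> F O map_prod f f ` E" by (force simp: i)
  qed
next
  assume "close \<E> R fst (f \<circ> snd)"
  from closeD[OF this]
  obtain F where F: "F \<in> \<E>" "\<And>i. i \<in> R \<Longrightarrow> (fst i, (f \<circ> snd) i) \<in> F" by blast
  have "R \<subseteq> F O graph X f O Id_on X"
    using F(2) assms(2) by (force simp: graph_def intro!: relcompI)
  then show "coarse_le \<E> R (graph X f)" unfolding coarse_le_def using F(1) ent_Id by blast
qed

text \<open>The rigidity behind all later equalities of classes. Given \<open>x\<close>, choose
  \<open>a\<close> in the domain of \<open>R\<close> near \<open>x\<close> and \<open>y\<close>
  related to \<open>a\<close>: then \<open>f x\<close> is near \<open>f a\<close> because
  \<open>f\<close> is controlled, and \<open>f a\<close> is near \<open>y\<close> by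
  assumption.\<close>

lemma graph_coarse_le:
  assumes f: "cmap f" and R: "R \<subseteq> X \<times> X" "coarse_le \<E> R (graph X f)" "coarsely_dense X \<E> (Range R)"
  shows "coarse_le \<E> (graph X f) R"
proof -
  obtain K where K: "K \<in> \<E>" "\<And>i. i \<in> R \<Longrightarrow> (fst i, (f \<circ> snd) i) \<in> K"
    using closeD[OF R(2)[unfolded coarse_le_graph_iff[OF f R(1)]]] by blast
  obtain E where E: "E \<in> \<E>" "X = rel_image E (Range R)"
    using R(3) unfolding coarsely_dense_def by blast
  define M where "M = map_prod f f ` E"
  have M: "M \<in> \<E>" using f E(1) by (simp add: M_def cmap_def)
  have "graph X f \<subseteq> (M O K\<inverse>) O R O E\<inverse>"
  proof
    fix i assume "i \<in> graph X f"
    then obtain x where x: "i = (f x, x)" "x \<in> X" by (auto simp: graph_def)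
    then obtain a y where a: "(x, a) \<in> E" "(y, a) \<in> R"
      using E(2) unfolding rel_image_def by blast
    then have "(f x, f a) \<in> M" "(y, f a) \<in> K" using K(2)[of "(y, a)"] by (auto simp: M_def)
    then show "i \<in> (M O K\<inverse>) O R O E\<inverse>" using a x(1) by blast
  qed
  then show ?thesis unfolding coarse_le_def using M K(1) E(1) ent_comp ent_converse by blast
qed

lemma coarse_class_eq_fun_class_iff:
  assumes "cmap f" "R \<subseteq> X \<times> X" "coarsely_dense X \<E> (Range R)"
  shows "coarse_class X \<E> R = fun_class X \<E> f \<longleftrightarrow> coarse_le \<E> R (graph X f)"
  unfolding fun_class_graph
  using coarse_class_eq_iff[OF assms(2) graph_space[OF cmap_space[OF assms(1)]]]
    graph_coarse_le[OF assms(1,2) _ assms(3)] by blast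

lemma coarsely_dense_space: "coarsely_dense X \<E> X"
  unfolding coarsely_dense_def rel_image_def using ent_Id by (auto intro!: bexI[of _ "Id_on X"])

lemma Range_graph: "Range (graph X f) = X"
  by (auto simp: graph_def)

lemma fun_class_eq_iff:
  assumes "cmap f" "g \<in> X \<rightarrow> X"
  shows "fun_class X \<E> g = fun_class X \<E> f \<longleftrightarrow> close \<E> X g f"
proof -
  have "fun_class X \<E> g = fun_class X \<E> f \<longleftrightarrow> coarse_le \<E> (graph X g) (graph X f)"
    using coarse_class_eq_fun_class_iff[OF assms(1) graph_space[OF assms(2)]]
    unfolding Range_graph fun_class_graph[of g] using coarsely_dense_space by blast
  also have "\<dots> \<longleftrightarrow> close \<E> (graph X g) fst (f \<circ> snd)"
    by (rule coarse_le_graph_iff[OF assms(1) graph_space[OF assms(2)]])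
  also have "(\<lambda>i. (fst i, (f \<circ> snd) i)) ` graph X g = (\<lambda>x. (g x, f x)) ` X"
    by (force simp: graph_def)
  then have "close \<E> (graph X g) fst (f \<circ> snd) \<longleftrightarrow> close \<E> X g f"
    by (simp add: close_def)
  finally show ?thesis .
qed

lemma controlled_rel_graph:
  assumes "cmap f"
  shows "controlled_rel \<E> (graph X f)"
  unfolding controlled_rel_def
proof
  fix E assume E: "E \<in> \<E>"
  have "graph X f O E O (graph X f)\<inverse> \<subseteq> map_prod f f ` E" by (force simp: graph_def)
  then show "graph X f O E O (graph X f)\<inverse> \<in> \<E>"
    using assms E ent_subset unfolding cmap_def by blast
qed

text \<open>\<open>f x\<close> is any value of \<open>R\<close> at a domain point \<open>a x\<close>
  near \<open>x\<close>. Since \<open>R\<close> sends nearby points to nearby values, such choices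
  are controlled and stay close to \<open>R\<close>.\<close>

lemma controlled_rel_imp_function:
  assumes R: "R \<subseteq> X \<times> X" "controlled_rel \<E> R" "coarsely_dense X \<E> (Range R)"
  obtains f where "cmap f" "coarse_class X \<E> R = fun_class X \<E> f"
proof -
  obtain E where E: "E \<in> \<E>" "X = rel_image E (Range R)"
    using R(3) unfolding coarsely_dense_def by blast
  then have "\<forall>x\<in>X. \<exists>y a. (x, a) \<in> E \<and> (y, a) \<in> R" unfolding rel_image_def by blast
  then obtain f where "\<forall>x\<in>X. \<exists>a. (x, a) \<in> E \<and> (f x, a) \<in> R" by metis
  then obtain a where fa: "\<And>x. x \<in> X \<Longrightarrow> (x, a x) \<in> E" "\<And>x. x \<in> X \<Longrightarrow> (f x, a x) \<in> R" by metis
  have f: "cmap f"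
    unfolding cmap_def
  proof (intro conjI ballI)
    show "f \<in> X \<rightarrow> X" using fa R(1) by blast
    fix F assume F: "F \<in> \<E>"
    have "R O (E\<inverse> O F O E) O R\<inverse> \<in> \<E>"
      using R(2) E(1) F unfolding controlled_rel_def by (simp add: ent_comp ent_converse)
    moreover have "map_prod f f ` F \<subseteq> R O (E\<inverse> O F O E) O R\<inverse>"
    proof
      fix i assume "i \<in> map_prod f f ` F"
      then obtain x y where i: "i = (f x, f y)" "(x, y) \<in> F" by auto
      then have "x \<in> X" "y \<in> X" using ent_space[OF F] by auto
      then show "i \<in> R O (E\<inverse> O F O E) O R\<inverse>" using fa i by blast
    qed
    ultimately show "map_prod f f ` F \<in> \<E>" by (rule ent_subset)
  qed
  have "close \<E> R fst (f \<circ> snd)"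
  proof (rule closeI)
    show "R O E O R\<inverse> \<in> \<E>" using R(2) E(1) unfolding controlled_rel_def by blast
    fix i assume "i \<in> R"
    moreover obtain y x where i: "i = (y, x)" by fastforce
    moreover have "x \<in> X" using R(1) calculation by auto
    ultimately show "(fst i, (f \<circ> snd) i) \<in> R O E O R\<inverse>" using fa[of x] by auto
  qed
  then have "coarse_class X \<E> R = fun_class X \<E> f"
    using coarse_class_eq_fun_class_iff[OF f R(1,3)] coarse_le_graph_iff[OF f R(1)] by blast
  with f show thesis using that by blast
qed

lemma coarse_map_iff: "coarse_map X \<E> C \<longleftrightarrow> (\<exists>f. cmap f \<and> C = fun_class X \<E> f)"
proof
  assume "coarse_map X \<E> C"
  then show "\<exists>f. cmap f \<and> C = fun_class X \<E> f"
    unfolding coarse_map_def using controlled_rel_imp_function by metis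
next
  assume "\<exists>f. cmap f \<and> C = fun_class X \<E> f"
  then obtain f where f: "cmap f" "C = fun_class X \<E> f" by blast
  then show "coarse_map X \<E> C"
    unfolding coarse_map_def fun_class_graph
    using graph_space[OF cmap_space] controlled_rel_graph Range_graph coarsely_dense_space by metis
qed

text \<open>Shows that the definite description in \<open>coarse_comp\<close> denotes: the composite
  class does not depend on the representatives.\<close>

lemma coarse_comp_fun_class:
  assumes f: "cmap f" and g: "cmap g"
  shows "coarse_comp X \<E> (fun_class X \<E> f) (fun_class X \<E> g) = fun_class X \<E> (f \<circ> g)"
  unfolding coarse_comp_def
proof (rule the_equality)
  show "\<exists>f' g'. f' \<in> X \<rightarrow> X \<and> g' \<in> X \<rightarrow> X \<and> fun_class X \<E> f = fun_class X \<E> f' \<and>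
      fun_class X \<E> g = fun_class X \<E> g' \<and> fun_class X \<E> (f \<circ> g) = fun_class X \<E> (f' \<circ> g')"
    using cmap_space f g by blast
next
  fix H assume "\<exists>f' g'. f' \<in> X \<rightarrow> X \<and> g' \<in> X \<rightarrow> X \<and> fun_class X \<E> f = fun_class X \<E> f' \<and>
      fun_class X \<E> g = fun_class X \<E> g' \<and> H = fun_class X \<E> (f' \<circ> g')"
  then obtain f' g' where *: "f' \<in> X \<rightarrow> X" "g' \<in> X \<rightarrow> X" "fun_class X \<E> f' = fun_class X \<E> f"
    "fun_class X \<E> g' = fun_class X \<E> g" "H = fun_class X \<E> (f' \<circ> g')" by metis
  have "close \<E> X f' f" "close \<E> X g' g" using * fun_class_eq_iff f g by blast+
  \<comment> \<open>The chain passes through \<open>f \<circ> g'\<close>: substituting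
    \<open>g'\<close> replaces \<open>f'\<close> by \<open>f\<close>, and control of
    \<open>f\<close> replaces \<open>g'\<close> by \<open>g\<close>. The competitors
    \<open>f'\<close> and \<open>g'\<close> are known only to map \<open>X\<close> to
    \<open>X\<close>.\<close>
  then have "close \<E> X (f' \<circ> g') (f \<circ> g)"
    using close_reindex[OF _ *(2)] cmap_close[OF f] close_trans by blast
  moreover have "f' \<circ> g' \<in> X \<rightarrow> X" using * by auto
  ultimately show "H = fun_class X \<E> (f \<circ> g)"
    using fun_class_eq_iff[OF cmap_comp[OF f g]] *(5) by blast
qed

lemma coarse_class_Id: "coarse_class X \<E> (Id_on X) = fun_class X \<E> id"
proof -
  have "Id_on X = graph X id" by (auto simp: graph_def)
  then show ?thesis by (simp add: fun_class_graph)
qed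

section \<open>The group of coarse equivalences\<close>

text \<open>Symmetric in \<open>f\<close> and \<open>g\<close>, so that one-sided arguments can be
  repeated with the roles exchanged.\<close>

definition coarse_inverses :: "('a \<Rightarrow> 'a) \<Rightarrow> ('a \<Rightarrow> 'a) \<Rightarrow> bool" where
  "coarse_inverses f g \<longleftrightarrow> cmap f \<and> cmap g \<and> close \<E> X (f \<circ> g) id \<and> close \<E> X (g \<circ> f) id"

lemma coarse_equivalence_iff:
  "coarse_equivalence X \<E> C \<longleftrightarrow> (\<exists>f g. coarse_inverses f g \<and> C = fun_class X \<E> f)"
proof -
  have *: "coarse_comp X \<E> (fun_class X \<E> f) (fun_class X \<E> g) = coarse_class X \<E> (Id_on X)
      \<longleftrightarrow> close \<E> X (f \<circ> g) id" if "cmap f" "cmap g" for f g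
    unfolding coarse_comp_fun_class[OF that] coarse_class_Id
    by (rule fun_class_eq_iff[OF cmap_id cmap_space[OF cmap_comp[OF that]]])
  show ?thesis
    unfolding coarse_equivalence_def coarse_map_iff coarse_inverses_def using * by blast
qed

lemma coarse_inverses_comp:
  assumes "coarse_inverses f f'" "coarse_inverses g g'"
  shows "coarse_inverses (f \<circ> g) (g' \<circ> f')"
proof -
  have *: "close \<E> X ((f \<circ> g) \<circ> (g' \<circ> f')) id"
    if "coarse_inverses f f'" "coarse_inverses g g'" for f f' g g'
  proof -
    have "f' \<in> X \<rightarrow> X" using that cmap_space by (auto simp: coarse_inverses_def)
    then have "close \<E> X (f \<circ> ((g \<circ> g') \<circ> f')) (f \<circ> (id \<circ> f'))"
      using that unfolding coarse_inverses_def by (intro cmap_close close_reindex[of X]) auto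
    then show ?thesis
      using that close_trans unfolding coarse_inverses_def by (simp add: comp_assoc) blast
  qed
  have "coarse_inverses g' g" "coarse_inverses f' f" using assms by (auto simp: coarse_inverses_def)
  then show ?thesis
    using * assms cmap_comp unfolding coarse_inverses_def[of "f \<circ> g"] by (simp add: coarse_inverses_def)
qed

lemma CE_carrier: "carrier (CE X \<E>) = {fun_class X \<E> f | f. \<exists>g. coarse_inverses f g}"
  by (auto simp: CE_def coarse_equivalence_iff)

lemma CE_one: "\<one>\<^bsub>CE X \<E>\<^esub> = fun_class X \<E> id"
  by (simp add: CE_def coarse_class_Id)

lemma CE_mult: "cmap f \<Longrightarrow> cmap g \<Longrightarrow>
    fun_class X \<E> f \<otimes>\<^bsub>CE X \<E>\<^esub> fun_class X \<E> g = fun_class X \<E> (f \<circ> g)"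
  by (simp add: CE_def coarse_comp_fun_class)

theorem group_CE: "group (CE X \<E>)"
proof (rule groupI)
  fix x y z
  assume "x \<in> carrier (CE X \<E>)" "y \<in> carrier (CE X \<E>)"
  then obtain f f' g g' where fg: "x = fun_class X \<E> f" "y = fun_class X \<E> g"
      "coarse_inverses f f'" "coarse_inverses g g'"
    unfolding CE_carrier by blast
  then have cm: "cmap f" "cmap g" by (auto simp: coarse_inverses_def)
  show "x \<otimes>\<^bsub>CE X \<E>\<^esub> y \<in> carrier (CE X \<E>)"
    using coarse_inverses_comp[OF fg(3,4)] by (auto simp: fg CE_mult[OF cm] CE_carrier)
  assume "z \<in> carrier (CE X \<E>)"
  then obtain h where h: "z = fun_class X \<E> h" "cmap h"
    unfolding CE_carrier coarse_inverses_def by blast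
  show "x \<otimes>\<^bsub>CE X \<E>\<^esub> y \<otimes>\<^bsub>CE X \<E>\<^esub> z = x \<otimes>\<^bsub>CE X \<E>\<^esub> (y \<otimes>\<^bsub>CE X \<E>\<^esub> z)"
    by (simp add: fg h CE_mult cm cmap_comp comp_assoc)
next
  show "\<one>\<^bsub>CE X \<E>\<^esub> \<in> carrier (CE X \<E>)"
  proof -
    have "coarse_inverses id id" using cmap_id close_refl[of id X] by (simp add: coarse_inverses_def)
    then show ?thesis unfolding CE_carrier CE_one by blast
  qed
next
  fix x assume "x \<in> carrier (CE X \<E>)"
  then obtain f f' where f: "x = fun_class X \<E> f" "coarse_inverses f f'"
    unfolding CE_carrier by blast
  then have cm: "cmap f" "cmap f'" "coarse_inverses f' f" by (auto simp: coarse_inverses_def)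
  show "\<one>\<^bsub>CE X \<E>\<^esub> \<otimes>\<^bsub>CE X \<E>\<^esub> x = x"
    by (simp add: f CE_one CE_mult cmap_id cm)
  have "fun_class X \<E> (f' \<circ> f) = fun_class X \<E> id"
    using fun_class_eq_iff[OF cmap_id cmap_space[OF cmap_comp[OF cm(2,1)]]] f(2)
    by (simp add: coarse_inverses_def)
  then show "\<exists>y\<in>carrier (CE X \<E>). y \<otimes>\<^bsub>CE X \<E>\<^esub> x = \<one>\<^bsub>CE X \<E>\<^esub>"
    using CE_mult[OF cm(2,1)] cm(3) unfolding CE_one f(1) CE_carrier by blast
qed

end

section \<open>Supports in discrete modules\<close>

lemma (in coarse) controlled_rel_entourage: "E \<in> \<E> \<Longrightarrow> controlled_rel \<E> E"
  unfolding controlled_rel_def by (simp add: ent_comp ent_converse)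

text \<open>The partition and gauge witnessing discreteness become parameters, so that blocks and
  their bases can be named throughout.\<close>

locale discrete_coarse_module = coarse X \<E> for X :: "'a set" and \<E> +
  fixes \<AA> :: "'a set set" and P :: "'a set \<Rightarrow> 'h::chilbert_space \<Rightarrow> 'h"
    and \<P> :: "'a set set" and \<Delta> :: "('a \<times> 'a) set" and \<kappa> :: "'k rel"
  assumes module: "coarse_module X \<E> \<AA> P"
    and gauge: "coarse_gauge X \<E> \<Delta>"
    and partition: "partition_on X \<P>"
    and blocks: "\<And>A. A \<in> \<P> \<Longrightarrow> A \<in> \<AA>" "\<And>A. A \<in> \<P> \<Longrightarrow> A \<times> A \<subseteq> \<Delta>"
    and blocks_sum: "\<And>v. ((\<lambda>A. P A v) has_sum v) \<P>"
    and blocks_complete: "\<And>C. C \<subseteq> X \<Longrightarrow> (\<And>A. A \<in> \<P> \<Longrightarrow> C \<inter> A \<in> \<AA>) \<Longrightarrow> C \<in> \<AA>"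
    and ample: "ample_module X \<E> \<AA> P \<kappa>"
    and local_rank: "local_rank_le \<E> \<AA> P \<kappa>"
begin

lemma gauge_ent: "\<Delta> \<in> \<E>"
  using gauge by (auto simp: coarse_gauge_def)

lemma block_gauge: "A \<in> \<P> \<Longrightarrow> x \<in> A \<Longrightarrow> y \<in> A \<Longrightarrow> (x, y) \<in> \<Delta>"
  using blocks by blast

lemma block_space: "A \<in> \<P> \<Longrightarrow> x \<in> A \<Longrightarrow> x \<in> X"
  and block_disjoint: "A \<in> \<P> \<Longrightarrow> B \<in> \<P> \<Longrightarrow> A \<noteq> B \<Longrightarrow> A \<inter> B = {}"
  using partition by (auto simp: partition_on_def disjoint_def)

lemma block_nonempty: "A \<in> \<P> \<Longrightarrow> \<exists>x. x \<in> A"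
  using partition by (metis partition_on_def ex_in_conv)

lemma meas_Int: "A \<in> \<AA> \<Longrightarrow> B \<in> \<AA> \<Longrightarrow> A \<inter> B \<in> \<AA>" and meas_empty: "{} \<in> \<AA>"
proof -
  have "algebra X \<AA>" using module by (simp add: coarse_module_def)
  then show "A \<in> \<AA> \<Longrightarrow> B \<in> \<AA> \<Longrightarrow> A \<inter> B \<in> \<AA>" "{} \<in> \<AA>"
    by (simp_all add: algebra_iff_Int)
qed

lemma P_projection: "A \<in> \<AA> \<Longrightarrow> is_projection (P A)"
  using module by (simp add: coarse_module_def)

lemmas P_linear = projection_clinear[OF P_projection]

lemma P_empty: "P {} v = 0"
  using module by (simp add: coarse_module_def)

lemma P_Int: "A \<in> \<AA> \<Longrightarrow> B \<in> \<AA> \<Longrightarrow> P A (P B v) = P (A \<inter> B) v"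
  using module by (simp add: coarse_module_def)

lemma P_commute: "A \<in> \<AA> \<Longrightarrow> B \<in> \<AA> \<Longrightarrow> P A (P B v) = P B (P A v)"
  by (simp add: P_Int Int_commute)

lemma P_zero: "A \<in> \<AA> \<Longrightarrow> P A 0 = 0"
  by (rule bounded_clinearD(4)[OF P_linear])

lemma eq_zero_if_blocks: "(\<And>A. A \<in> \<P> \<Longrightarrow> P A v = 0) \<Longrightarrow> v = 0"
  using has_sum_unique[OF blocks_sum[of v] has_sum_0] by blast

lemma linear_eq_zero_if_blocks:
  assumes t: "bounded_clinear t" and "\<And>A. A \<in> \<P> \<Longrightarrow> t (P A v) = 0"
  shows "t v = 0"
proof -
  have "((\<lambda>A. t (P A v)) has_sum t v) \<P>"
    by (rule has_sum_bounded_linear[OF bounded_clinearD(1)[OF t] blocks_sum])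
  then show ?thesis using has_sum_unique[OF _ has_sum_0] assms(2) by blast
qed

section \<open>Block supports as representatives of coarse supports\<close>

definition block_supp :: "('h \<Rightarrow> 'h) \<Rightarrow> ('a \<times> 'a) set" where
  "block_supp t = \<Union> {B \<times> A | B A. B \<in> \<P> \<and> A \<in> \<P> \<and> (\<exists>v. P B (t (P A v)) \<noteq> 0)}"

lemma block_suppI:
  "B \<in> \<P> \<Longrightarrow> A \<in> \<P> \<Longrightarrow> P B (t (P A v)) \<noteq> 0 \<Longrightarrow> y \<in> B \<Longrightarrow> x \<in> A \<Longrightarrow> (y, x) \<in> block_supp t"
  unfolding block_supp_def by blast

lemma block_suppE:
  assumes "(y, x) \<in> block_supp t"
  obtains B A v where "B \<in> \<P>" "A \<in> \<P>" "y \<in> B" "x \<in> A" "P B (t (P A v)) \<noteq> 0"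
proof -
  obtain B A where BA: "B \<in> \<P>" "A \<in> \<P>" "(y, x) \<in> B \<times> A" "\<exists>v. P B (t (P A v)) \<noteq> 0"
    using assms unfolding block_supp_def by auto
  then obtain v where "P B (t (P A v)) \<noteq> 0" by (elim exE)
  with BA show thesis using that[of B A v] by simp
qed

lemma block_supp_space: "block_supp t \<subseteq> X \<times> X"
proof (rule subrelI)
  fix y x assume "(y, x) \<in> block_supp t"
  then obtain B A v where "B \<in> \<P>" "A \<in> \<P>" "y \<in> B" "x \<in> A" by (rule block_suppE)
  then show "(y, x) \<in> X \<times> X" using block_space by simp
qed

text \<open>\<open>P B \<circ> t \<circ> P A\<close> is tested on pairs of blocks \<open>B'\<close>,
  \<open>A'\<close>. If a block misses its measurable set the entry is zero; otherwise points of the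
  two intersections turn a nonzero entry of \<open>t\<close> into a violation of separation.\<close>

lemma supp_in_block_supp:
  assumes t: "bounded_clinear t"
  shows "supp_in \<AA> P t (block_supp t)"
  unfolding supp_in_def
proof (intro ballI impI ext)
  fix B A v assume AB: "B \<in> \<AA>" "A \<in> \<AA>" and sep: "separated (block_supp t) B A"
  have "P B' (P B (t (P A' (P A v)))) = 0" if B': "B' \<in> \<P>" and A': "A' \<in> \<P>" for B' A'
  proof (cases "B \<inter> B' = {} \<or> A \<inter> A' = {}")
    case True
    have "P B' (P B (t (P A' (P A v)))) = P (B' \<inter> B) (t (P (A' \<inter> A) v))"
      using blocks(1)[OF A'] blocks(1)[OF B'] AB by (simp add: P_Int)
    also have "\<dots> = 0" using True blocks(1)[OF B'] AB
      by (auto simp: P_empty Int_commute bounded_clinearD(4)[OF t] P_zero meas_Int)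
    finally show ?thesis .
  next
    case False
    then obtain y x where "y \<in> B" "y \<in> B'" "x \<in> A" "x \<in> A'" by blast
    then have "P B' (t (P A' (P A v))) = 0"
      using block_suppI[OF B' A'] sep unfolding separated_def rel_image_def by blast
    then show ?thesis using P_commute[OF blocks(1)[OF B'] AB(1)] P_zero AB by simp
  qed
  moreover have "bounded_clinear (P B' \<circ> P B \<circ> t)" if "B' \<in> \<P>" for B'
    using P_linear blocks that t AB by (intro bounded_clinear_comp) auto
  ultimately have "P B' (P B (t (P A v))) = 0" if "B' \<in> \<P>" for B'
    using linear_eq_zero_if_blocks[of "P B' \<circ> P B \<circ> t" "P A v"] that by simp
  then show "(P B \<circ> t \<circ> P A) v = 0" using eq_zero_if_blocks[of "P B (t (P A v))"] by simp
qed

text \<open>A nonzero entry forces \<open>R\<close> to meet \<open>B \<times> A\<close>, and within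
  a block any two points are \<open>\<Delta>\<close>-close. Thus the block support is coarsely
  minimal.\<close>

lemma block_supp_subset:
  assumes "supp_in \<AA> P t R"
  shows "block_supp t \<subseteq> \<Delta> O R O \<Delta>"
proof (clarsimp elim!: block_suppE)
  fix y x B A v
  assume *: "B \<in> \<P>" "A \<in> \<P>" "y \<in> B" "x \<in> A" "P B (t (P A v)) \<noteq> 0"
  then have "\<not> separated R B A"
    using assms blocks(1) unfolding supp_in_def by (metis comp_apply)
  then obtain b a where "b \<in> B" "a \<in> A" "(b, a) \<in> R"
    unfolding separated_def rel_image_def by blast
  then show "(y, x) \<in> \<Delta> O R O \<Delta>" using * block_gauge by (meson relcompI)
qed

lemma block_supp_le:
  assumes "supp_in \<AA> P t R"
  shows "coarse_le \<E> (block_supp t) R"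
  unfolding coarse_le_def
  by (rule bexI[OF _ gauge_ent], rule bexI[OF _ gauge_ent], rule block_supp_subset[OF assms])

lemma coarse_support_eq:
  assumes t: "bounded_clinear t"
  shows "coarse_support X \<E> \<AA> P t = coarse_class X \<E> (block_supp t)"
  unfolding coarse_support_def
proof (rule the_equality)
  show "\<exists>S. S \<subseteq> X \<times> X \<and> coarse_class X \<E> (block_supp t) = coarse_class X \<E> S \<and> supp_in \<AA> P t S \<and>
      (\<forall>R. R \<subseteq> X \<times> X \<and> supp_in \<AA> P t R \<longrightarrow> coarse_le \<E> S R)"
    using block_supp_space supp_in_block_supp[OF t] block_supp_le by blast
next
  fix C assume "\<exists>S. S \<subseteq> X \<times> X \<and> C = coarse_class X \<E> S \<and> supp_in \<AA> P t S \<and>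
      (\<forall>R. R \<subseteq> X \<times> X \<and> supp_in \<AA> P t R \<longrightarrow> coarse_le \<E> S R)"
  then obtain S where S: "S \<subseteq> X \<times> X" "C = coarse_class X \<E> S" "supp_in \<AA> P t S"
      "\<And>R. R \<subseteq> X \<times> X \<Longrightarrow> supp_in \<AA> P t R \<Longrightarrow> coarse_le \<E> S R" by blast
  then show "C = coarse_class X \<E> (block_supp t)"
    using coarse_class_eq_iff[OF S(1) block_supp_space] block_supp_le[OF S(3)]
      S(4)[OF block_supp_space supp_in_block_supp[OF t]] by simp
qed

lemma controlled_op_iff:
  "bounded_clinear t \<Longrightarrow> controlled_op X \<E> \<AA> P t \<longleftrightarrow> controlled_rel \<E> (block_supp t)"
  unfolding controlled_op_def coarse_support_eq
  by (rule partial_coarse_map_class_iff[OF block_supp_space])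

lemma block_supp_cadjoint:
  assumes t: "bounded_clinear t"
  shows "block_supp (cadjoint t) = (block_supp t)\<inverse>"
proof -
  have *: "cinner (P A (cadjoint t (P B v))) w = cinner v (P B (t (P A w)))" if "A \<in> \<P>" "B \<in> \<P>" for A B v w
    using that blocks(1) by (simp add: cinner_projection P_projection cinner_cadjoint'[OF t])
  have iff: "(\<exists>v. P A (cadjoint t (P B v)) \<noteq> 0) \<longleftrightarrow> (\<exists>w. P B (t (P A w)) \<noteq> 0)"
    if "A \<in> \<P>" "B \<in> \<P>" for A B
    using *[OF that] by (metis cinner_self_eq_0 cinner_zero_left cinner_zero_right)
  show ?thesis
  proof (intro equalityI subrelI)
    fix x y assume "(x, y) \<in> block_supp (cadjoint t)"
    then obtain A B v where AB: "A \<in> \<P>" "B \<in> \<P>" "x \<in> A" "y \<in> B" "P A (cadjoint t (P B v)) \<noteq> 0"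
      by (rule block_suppE)
    then obtain w where "P B (t (P A w)) \<noteq> 0" using iff[OF AB(1,2)] by metis
    then show "(x, y) \<in> (block_supp t)\<inverse>" using block_suppI[where v = w] AB by simp
  next
    fix x y assume "(x, y) \<in> (block_supp t)\<inverse>"
    then have "(y, x) \<in> block_supp t" by simp
    then obtain B A v where AB: "B \<in> \<P>" "A \<in> \<P>" "y \<in> B" "x \<in> A" "P B (t (P A v)) \<noteq> 0"
      by (rule block_suppE)
    then obtain w where "P A (cadjoint t (P B w)) \<noteq> 0" using iff[OF AB(2,1)] by metis
    then show "(x, y) \<in> block_supp (cadjoint t)" using block_suppI[where v = w] AB by simp
  qed
qed

text \<open>Expanding \<open>t (P A v)\<close> over the middle blocks, some term must survive under
  \<open>P C \<circ> s\<close>.\<close>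

lemma block_supp_comp:
  assumes s: "bounded_clinear s" and t: "bounded_clinear t"
  shows "block_supp (s \<circ> t) \<subseteq> block_supp s O block_supp t"
proof (clarsimp elim!: block_suppE)
  fix y x C A v
  assume *: "C \<in> \<P>" "A \<in> \<P>" "y \<in> C" "x \<in> A" "P C (s (t (P A v))) \<noteq> 0"
  then have "bounded_clinear (P C \<circ> s)" using P_linear blocks(1) s bounded_clinear_comp by blast
  then obtain B where B: "B \<in> \<P>" "P C (s (P B (t (P A v)))) \<noteq> 0"
    using linear_eq_zero_if_blocks[of "P C \<circ> s" "t (P A v)"] *(5) by auto
  then have "P B (t (P A v)) \<noteq> 0"
    using bounded_clinearD(4)[OF s] P_zero[OF blocks(1)[OF *(1)]] by auto
  moreover obtain z where "z \<in> B" using block_nonempty[OF B(1)] by blast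
  ultimately show "(y, x) \<in> block_supp s O block_supp t"
    using * B block_suppI by (meson relcompI)
qed

lemma block_supp_id: "block_supp id \<subseteq> \<Delta>"
proof (clarsimp elim!: block_suppE)
  fix y x B A v
  assume *: "B \<in> \<P>" "A \<in> \<P>" "y \<in> B" "x \<in> A" "P B (P A v) \<noteq> 0"
  then have "B \<inter> A \<noteq> {}" using P_Int blocks(1) P_empty by metis
  then have "B = A" using block_disjoint * by blast
  then show "(y, x) \<in> \<Delta>" using * block_gauge by blast
qed

lemma Ccp_iff:
  assumes "bounded_clinear t"
  shows "t \<in> Ccp \<E> \<AA> P \<longleftrightarrow> block_supp t \<in> \<E>"
proof
  assume "t \<in> Ccp \<E> \<AA> P"
  then obtain E where "E \<in> \<E>" "supp_in \<AA> P t E" unfolding Ccp_def by blast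
  then show "block_supp t \<in> \<E>"
    using block_supp_subset gauge_ent ent_comp ent_subset by meson
qed (use assms supp_in_block_supp in \<open>auto simp: Ccp_def\<close>)

subsection \<open>Orthonormal bases of the blocks\<close>

text \<open>The same choice as in \<open>projection_rank\<close>, so ranks are literally the
  cardinalities of these bases.\<close>

definition basis :: "'a set \<Rightarrow> 'h set" where
  "basis A = (SOME B. orthonormal_basis (range (P A)) B)"

lemma projection_rank_basis: "projection_rank (P A) = |basis A|"
  by (simp add: projection_rank_def basis_def)

lemma basis:
  assumes "A \<in> \<AA>"
  shows "orthonormal (basis A)" "closure (cspan (basis A)) = range (P A)"
proof -
  have "orthonormal_basis (range (P A)) (basis A)"
    unfolding basis_def
    using orthonormal_basis_exists[OF csubspace_range_projection closed_range_projection]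
      P_projection[OF assms]
    by (metis someI_ex)
  then show "orthonormal (basis A)" "closure (cspan (basis A)) = range (P A)"
    by (auto simp: orthonormal_basis_iff)
qed

lemma range_P: "A \<in> \<AA> \<Longrightarrow> range (P A) = {v. P A v = v}"
  by (rule range_projection[OF P_projection])

lemma P_basis: "A \<in> \<AA> \<Longrightarrow> b \<in> basis A \<Longrightarrow> P A b = b"
  using basis(2) range_P closure_subset[of "cspan (basis A)"] complex_vector.span_base[of b "basis A"]
  by auto

lemma P_subset: "A \<in> \<AA> \<Longrightarrow> B \<in> \<AA> \<Longrightarrow> A \<subseteq> B \<Longrightarrow> P A v = v \<Longrightarrow> P B v = v"
  by (metis P_Int Int_absorb1)

text \<open>Used both for monotonicity of the rank and for bounding how many basis vectors live over
  a bounded set.\<close>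

lemma card_le_basis:
  assumes "A \<in> \<AA>" "orthonormal S" "\<And>s. s \<in> S \<Longrightarrow> P A s = s"
  shows "|S| \<le>o |basis A|"
  by (rule card_orthonormal_le[OF basis(1)[OF assms(1)] assms(2)])
    (simp add: basis(2)[OF assms(1)] range_P[OF assms(1)] assms(3) subset_iff)

text \<open>The substitute, among the blocks, for the sets supplied by ampleness, which need not be
  blocks.\<close>

definition good :: "'a set \<Rightarrow> bool" where
  "good A \<longleftrightarrow> A \<in> \<P> \<and> P A \<noteq> (\<lambda>v. 0) \<and> \<kappa> \<le>o |basis A|"

text \<open>Some block \<open>A\<close> meets a nonzero ample set \<open>D\<close> in a set with
  nonzero projection. That block inherits the rank of \<open>A \<inter> D\<close> and contains a
  point of \<open>D\<close>.\<close>

lemma good_dense: "\<exists>F\<in>\<E>. \<forall>x\<in>X. \<exists>A. good A \<and> (\<exists>a\<in>A. (x, a) \<in> F)"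
proof -
  obtain G where G: "coarse_gauge X \<E> G"
    and dense: "coarsely_dense X \<E> (\<Union> {A \<in> \<AA>. A \<times> A \<subseteq> G \<and> P A \<noteq> (\<lambda>v. 0)})"
    and rank: "\<And>A. A\<in>\<AA> \<Longrightarrow> A \<times> A \<subseteq> G \<Longrightarrow> P A \<noteq> (\<lambda>v. 0) \<Longrightarrow> \<kappa> \<le>o |basis A|"
    using ample unfolding ample_module_def projection_rank_basis by blast
  obtain E where E: "E \<in> \<E>" "X = rel_image E (\<Union> {A \<in> \<AA>. A \<times> A \<subseteq> G \<and> P A \<noteq> (\<lambda>v. 0)})"
    using dense unfolding coarsely_dense_def by blast
  have "\<exists>A. good A \<and> (\<exists>a\<in>A. (x, a) \<in> E O G)" if "x \<in> X" for x
  proof -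
    obtain y D where D: "(x, y) \<in> E" "y \<in> D" "D \<in> \<AA>" "D \<times> D \<subseteq> G" "P D \<noteq> (\<lambda>v. 0)"
      using equalityD1[OF E(2), THEN subsetD, OF \<open>x \<in> X\<close>] unfolding rel_image_def by blast
    then obtain v where "P D v \<noteq> 0" by blast
    then obtain A where A: "A \<in> \<P>" "P A (P D v) \<noteq> 0" using eq_zero_if_blocks by blast
    note Am = blocks(1)[OF A(1)]
    have AD: "P (A \<inter> D) v \<noteq> 0" "A \<inter> D \<in> \<AA>"
      using A(2) P_Int[OF Am D(3)] meas_Int[OF Am D(3)] by auto
    \<comment> \<open>\<open>A \<inter> D\<close> is measurable, nonzero and still
      \<open>G\<close>-bounded, so the rank condition of ampleness applies to it directly.\<close>
    then have "\<kappa> \<le>o |basis (A \<inter> D)|" using D(4) by (intro rank) auto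
    also have "|basis (A \<inter> D)| \<le>o |basis A|"
      using AD(2) Am P_subset[OF AD(2) Am] P_basis basis by (intro card_le_basis) auto
    finally have "good A" using A unfolding good_def by metis
    moreover obtain a where "a \<in> A" "a \<in> D" using AD(1) P_empty by (metis disjoint_iff)
    ultimately show ?thesis using D by blast
  qed
  moreover have "E O G \<in> \<E>" using ent_comp[OF E(1), of G] G by (simp add: coarse_gauge_def)
  ultimately show ?thesis by blast
qed

text \<open>\<open>u\<close> is injective, so a block with nonzero projection has a nonzero entry in
  its column; good blocks of this kind are coarsely dense.\<close>

lemma Range_block_supp_dense:
  assumes u: "unitary u"
  shows "coarsely_dense X \<E> (Range (block_supp u))"
proof -
  obtain F where F: "F \<in> \<E>" "\<And>x. x \<in> X \<Longrightarrow> \<exists>A. good A \<and> (\<exists>a\<in>A. (x, a) \<in> F)"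
    using good_dense by blast
  have "\<exists>a\<in>Range (block_supp u). (x, a) \<in> F" if "x \<in> X" for x
  proof -
    obtain A a where A: "good A" "a \<in> A" "(x, a) \<in> F" using F(2) \<open>x \<in> X\<close> by blast
    then obtain v where v: "A \<in> \<P>" "P A v \<noteq> 0" unfolding good_def by blast
    then have "u (P A v) \<noteq> 0"
      using unitary_adj_apply(1)[OF u, of "P A v"] bounded_clinearD(4)[OF unitary_clinear[OF unitary_cadjoint[OF u]]]
      by metis
    then obtain B where B: "B \<in> \<P>" "P B (u (P A v)) \<noteq> 0" using eq_zero_if_blocks by blast
    obtain y where "y \<in> B" using block_nonempty[OF B(1)] by blast
    then have "(y, a) \<in> block_supp u" using block_suppI[where v = v] B v(1) A(2) by blast
    then show ?thesis using A(3) by blast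
  qed
  then have "X = rel_image F (Range (block_supp u))"
    using ent_space[OF F(1)] unfolding rel_image_def by blast
  then show ?thesis using F(1) block_supp_space[of u] unfolding coarsely_dense_def by blast
qed

subsection \<open>The group of controlled unitaries\<close>

lemma CtrUni_carrier_iff:
  "u \<in> carrier (CtrUni X \<E> \<AA> P) \<longleftrightarrow>
    unitary u \<and> controlled_rel \<E> (block_supp u) \<and> controlled_rel \<E> ((block_supp u)\<inverse>)"
proof (cases "unitary u")
  case True
  note lin = unitary_clinear[OF True] unitary_clinear[OF unitary_cadjoint[OF True]]
  show ?thesis
    by (simp add: CtrUni_def True controlled_op_iff[OF lin(1)] controlled_op_iff[OF lin(2)]
        block_supp_cadjoint[OF lin(1)])
qed (simp add: CtrUni_def)

lemma CtrUni_comp: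
  assumes "u \<in> carrier (CtrUni X \<E> \<AA> P)" "v \<in> carrier (CtrUni X \<E> \<AA> P)"
  shows "u \<circ> v \<in> carrier (CtrUni X \<E> \<AA> P)"
proof -
  have sub: "block_supp (u \<circ> v) \<subseteq> block_supp u O block_supp v"
    using assms by (intro block_supp_comp) (auto simp: CtrUni_carrier_iff unitary_clinear)
  then have sub': "(block_supp (u \<circ> v))\<inverse> \<subseteq> (block_supp v)\<inverse> O (block_supp u)\<inverse>" by blast
  have "block_supp u O block_supp v \<subseteq> X \<times> X" "(block_supp v)\<inverse> O (block_supp u)\<inverse> \<subseteq> X \<times> X"
    using block_supp_space[of u] block_supp_space[of v] by blast+
  note le = coarse_le_subset[OF sub this(1)] coarse_le_subset[OF sub' this(2)]
  show ?thesis
    using assms controlled_rel_le[OF _ le(1)] controlled_rel_le[OF _ le(2)]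
    by (simp add: CtrUni_carrier_iff unitary_comp controlled_rel_comp)
qed

lemma CtrUni_cadjoint:
  "u \<in> carrier (CtrUni X \<E> \<AA> P) \<Longrightarrow> cadjoint u \<in> carrier (CtrUni X \<E> \<AA> P)"
  by (simp add: CtrUni_carrier_iff unitary_cadjoint block_supp_cadjoint unitary_clinear)

lemma CtrUni_if_UCcp:
  assumes "u \<in> UCcp \<E> \<AA> P"
  shows "u \<in> carrier (CtrUni X \<E> \<AA> P)"
proof -
  have u: "unitary u" "block_supp u \<in> \<E>"
    using assms Ccp_iff[OF unitary_clinear] by (auto simp: UCcp_def)
  then show ?thesis unfolding CtrUni_carrier_iff by (simp add: controlled_rel_entourage ent_converse)
qed

lemma id_UCcp: "id \<in> UCcp \<E> \<AA> P"
  using ent_subset[OF gauge_ent block_supp_id]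
  by (simp add: UCcp_def Ccp_iff[OF bounded_clinear_id] unitary_id)

lemmas CtrUni_id = CtrUni_if_UCcp[OF id_UCcp]

lemma CtrUni_simps:
  "u \<otimes>\<^bsub>CtrUni X \<E> \<AA> P\<^esub> v = u \<circ> v" "\<one>\<^bsub>CtrUni X \<E> \<AA> P\<^esub> = id"
  by (simp_all add: CtrUni_def)

theorem group_CtrUni: "group (CtrUni X \<E> \<AA> P)"
proof (rule groupI, unfold CtrUni_simps)
  show "id \<in> carrier (CtrUni X \<E> \<AA> P)" by (rule CtrUni_id)
next
  fix u assume u: "u \<in> carrier (CtrUni X \<E> \<AA> P)"
  show "id \<circ> u = u" by (rule id_comp)
  have "cadjoint u \<circ> u = id" using u unfolding CtrUni_carrier_iff unitary_def by blast
  then show "\<exists>v\<in>carrier (CtrUni X \<E> \<AA> P). v \<circ> u = id"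
    using CtrUni_cadjoint[OF u] by (rule rev_bexI[rotated])
  show "u \<circ> v \<in> carrier (CtrUni X \<E> \<AA> P)" if "v \<in> carrier (CtrUni X \<E> \<AA> P)" for v
    using u that by (rule CtrUni_comp)
  show "u \<circ> v \<circ> w = u \<circ> (v \<circ> w)" for v w by (rule comp_assoc)
qed

section \<open>The coarse support as a group homomorphism\<close>

lemma coarse_support_eq_fun_class_iff:
  assumes "unitary u" "cmap f"
  shows "coarse_support X \<E> \<AA> P u = fun_class X \<E> f \<longleftrightarrow> coarse_le \<E> (block_supp u) (graph X f)"
  unfolding coarse_support_eq[OF unitary_clinear[OF assms(1)]]
  by (rule coarse_class_eq_fun_class_iff[OF assms(2) block_supp_space Range_block_supp_dense[OF assms(1)]])

lemma coarse_support_function: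
  assumes "u \<in> carrier (CtrUni X \<E> \<AA> P)"
  obtains f where "cmap f" "coarse_support X \<E> \<AA> P u = fun_class X \<E> f"
proof -
  have u: "unitary u" "controlled_rel \<E> (block_supp u)" using assms by (auto simp: CtrUni_carrier_iff)
  show thesis
    using controlled_rel_imp_function[OF block_supp_space u(2) Range_block_supp_dense[OF u(1)]]
      coarse_support_eq[OF unitary_clinear[OF u(1)]] that by metis
qed

lemma coarse_support_comp:
  assumes u: "unitary u" "cmap f" "coarse_support X \<E> \<AA> P u = fun_class X \<E> f"
    and v: "unitary v" "cmap g" "coarse_support X \<E> \<AA> P v = fun_class X \<E> g"
  shows "coarse_support X \<E> \<AA> P (u \<circ> v) = fun_class X \<E> (f \<circ> g)"
proof -
  have cl: "close \<E> (block_supp w) fst (h \<circ> snd)"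
    if "unitary w" "cmap h" "coarse_support X \<E> \<AA> P w = fun_class X \<E> h" for w h
    using iffD1[OF coarse_support_eq_fun_class_iff[OF that(1,2)] that(3)]
    by (rule iffD1[OF coarse_le_graph_iff[OF that(2) block_supp_space]])
  have "\<exists>E\<in>\<E>. \<forall>i\<in>block_supp u. (fst i, f (snd i)) \<in> E"
    using closeD[OF cl[OF u]] by simp
  moreover have "\<exists>F\<in>\<E>. \<forall>i\<in>block_supp v. (f (fst i), f (g (snd i))) \<in> F"
    using closeD[OF cmap_close[OF u(2) cl[OF v]]] by simp
  ultimately obtain E F where E: "E \<in> \<E>" "\<And>i. i \<in> block_supp u \<Longrightarrow> (fst i, f (snd i)) \<in> E"
    and F: "F \<in> \<E>" "\<And>i. i \<in> block_supp v \<Longrightarrow> (f (fst i), f (g (snd i))) \<in> F"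
    by blast
  have "close \<E> (block_supp (u \<circ> v)) fst ((f \<circ> g) \<circ> snd)"
  proof (rule closeI[OF ent_comp[OF E(1) F(1)]])
    fix i assume "i \<in> block_supp (u \<circ> v)"
    then have "i \<in> block_supp u O block_supp v"
      using block_supp_comp[OF unitary_clinear[OF u(1)] unitary_clinear[OF v(1)]] by blast
    then obtain z y x where "i = (z, x)" "(z, y) \<in> block_supp u" "(y, x) \<in> block_supp v" by blast
    then show "(fst i, ((f \<circ> g) \<circ> snd) i) \<in> E O F"
      using E(2)[of "(z, y)"] F(2)[of "(y, x)"] by auto
  qed
  then have "coarse_le \<E> (block_supp (u \<circ> v)) (graph X (f \<circ> g))"
    by (rule iffD2[OF coarse_le_graph_iff[OF cmap_comp[OF u(2) v(2)] block_supp_space]])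
  then show ?thesis
    by (rule iffD2[OF coarse_support_eq_fun_class_iff[OF unitary_comp[OF u(1) v(1)] cmap_comp[OF u(2) v(2)]]])
qed

text \<open>Closeness of the two projections on \<open>block_supp u\<close> says precisely that this
  relation is an entourage. This identifies the kernel.\<close>

lemma coarse_support_id_iff:
  assumes u: "unitary u"
  shows "coarse_support X \<E> \<AA> P u = fun_class X \<E> id \<longleftrightarrow> u \<in> UCcp \<E> \<AA> P"
proof -
  have "coarse_support X \<E> \<AA> P u = fun_class X \<E> id \<longleftrightarrow> close \<E> (block_supp u) fst snd"
    unfolding coarse_support_eq_fun_class_iff[OF u cmap_id] coarse_le_graph_iff[OF cmap_id block_supp_space]
    by simp
  also have "\<dots> \<longleftrightarrow> u \<in> UCcp \<E> \<AA> P"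
    by (simp add: close_def UCcp_def u Ccp_iff[OF unitary_clinear[OF u]])
  finally show ?thesis .
qed

text \<open>Functions representing the supports of \<open>u\<close> and \<open>cadjoint u\<close>
  are coarse inverses, because both products of the operators are \<open>id\<close>, whose support
  is the identity class.\<close>

lemma coarse_support_CE:
  assumes u: "u \<in> carrier (CtrUni X \<E> \<AA> P)"
  shows "coarse_support X \<E> \<AA> P u \<in> carrier (CE X \<E>)"
proof -
  have *: "close \<E> X (f \<circ> g) id"
    if "unitary v" "cmap f" "coarse_support X \<E> \<AA> P v = fun_class X \<E> f"
      "unitary w" "cmap g" "coarse_support X \<E> \<AA> P w = fun_class X \<E> g" "v \<circ> w = id" for v w f g
  proof -
    have "fun_class X \<E> (f \<circ> g) = fun_class X \<E> id"
      using coarse_support_comp[OF that(1-6)] coarse_support_id_iff[OF unitary_id] id_UCcp \<open>v \<circ> w = id\<close>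
      by simp
    then show ?thesis
      using fun_class_eq_iff[OF cmap_id cmap_space[OF cmap_comp[OF that(2,5)]]] by blast
  qed
  have uu: "unitary u" "unitary (cadjoint u)" "u \<circ> cadjoint u = id" "cadjoint u \<circ> u = id"
    using u unitary_cadjoint by (auto simp: CtrUni_carrier_iff unitary_def)
  obtain f where f: "cmap f" "coarse_support X \<E> \<AA> P u = fun_class X \<E> f"
    using coarse_support_function[OF u] by blast
  obtain g where g: "cmap g" "coarse_support X \<E> \<AA> P (cadjoint u) = fun_class X \<E> g"
    using coarse_support_function[OF CtrUni_cadjoint[OF u]] by blast
  have "coarse_inverses f g"
    using *[OF uu(1) f uu(2) g uu(3)] *[OF uu(2) g uu(1) f uu(4)] f(1) g(1)
    by (simp add: coarse_inverses_def)
  then show ?thesis unfolding CE_carrier f(2) by blast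
qed

sublocale support: group_hom "CtrUni X \<E> \<AA> P" "CE X \<E>" "coarse_support X \<E> \<AA> P"
proof (intro group_hom.intro group_hom_axioms.intro group_CtrUni group_CE homI coarse_support_CE)
  fix u v assume u: "u \<in> carrier (CtrUni X \<E> \<AA> P)" and v: "v \<in> carrier (CtrUni X \<E> \<AA> P)"
  obtain f g where f: "cmap f" "coarse_support X \<E> \<AA> P u = fun_class X \<E> f"
    and g: "cmap g" "coarse_support X \<E> \<AA> P v = fun_class X \<E> g"
    using coarse_support_function[OF u] coarse_support_function[OF v] by metis
  have "unitary u" "unitary v" using u v by (auto simp: CtrUni_carrier_iff)
  then show "coarse_support X \<E> \<AA> P (u \<otimes>\<^bsub>CtrUni X \<E> \<AA> P\<^esub> v)
      = coarse_support X \<E> \<AA> P u \<otimes>\<^bsub>CE X \<E>\<^esub> coarse_support X \<E> \<AA> P v"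
    using coarse_support_comp f g CE_mult[OF f(1) g(1)] by (simp add: CtrUni_simps)
qed

lemma kernel_support: "kernel (CtrUni X \<E> \<AA> P) (CE X \<E>) (coarse_support X \<E> \<AA> P) = UCcp \<E> \<AA> P"
  unfolding kernel_def CE_one using coarse_support_id_iff CtrUni_carrier_iff CtrUni_if_UCcp by blast

end

section \<open>Unitaries implementing coarse equivalences\<close>

text \<open>The alternative for each \<open>a\<close> is the point: any estimate satisfied by
  \<open>f\<close>, and by \<open>g\<close> in the reverse direction, passes to
  \<open>h\<close>.\<close>

lemma Schroeder_Bernstein_pointwise:
  assumes f: "inj_on f A" "f ` A \<subseteq> B" and g: "inj_on g B" "g ` B \<subseteq> A"
  obtains h where "bij_betw h A B" "\<And>a. a \<in> A \<Longrightarrow> h a = f a \<or> g (h a) = a"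
proof -
  \<comment> \<open>\<open>D\<close> is the least set containing the points of \<open>A\<close>
    outside the image of \<open>g\<close> and closed under \<open>g \<circ> f\<close>. There
    \<open>h\<close> follows \<open>f\<close>; elsewhere it inverts \<open>g\<close>.\<close>
  define D where "D = lfp (\<lambda>Z. A - g ` (B - f ` Z))"
  have "mono (\<lambda>Z. A - g ` (B - f ` Z))" by (intro monoI) blast
  from lfp_unfold[OF this] have D: "D = A - g ` (B - f ` D)" by (simp add: D_def)
  have D_out: "a \<in> D \<longleftrightarrow> a \<in> A \<and> a \<notin> g ` (B - f ` D)" for a
    by (subst D) simp
  have DA: "D \<subseteq> A" using D_out by blast
  define h where "h a = (if a \<in> D then f a else inv_into B g a)" for a
  \<comment> \<open>Off \<open>D\<close> the values of \<open>h\<close> avoid the image of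
    \<open>D\<close> under \<open>f\<close>, so the two pieces of \<open>h\<close> cannot
    collide.\<close>
  have out: "h a \<in> B - f ` D" "g (h a) = a" if a: "a \<in> A" "a \<notin> D" for a
  proof -
    obtain b where b: "b \<in> B - f ` D" "a = g b" using D_out[of a] a by auto
    then have "h a = b" using a(2) g(1) by (simp add: h_def)
    then show "h a \<in> B - f ` D" "g (h a) = a" using b by auto
  qed
  have "inj_on h A"
  proof (rule inj_onI)
    fix a a' assume *: "a \<in> A" "a' \<in> A" "h a = h a'"
    have fD: "h x = f x" "h x \<in> f ` D" if "x \<in> D" for x using that by (auto simp: h_def)
    consider "a \<in> D" "a' \<in> D" | "a \<notin> D" "a' \<notin> D"
      using * out(1)[of a] out(1)[of a'] fD(2)[of a] fD(2)[of a'] by auto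
    then show "a = a'"
    proof cases
      case 1 then show ?thesis using * fD(1) f(1) by (metis inj_onD)
    next
      case 2 then show ?thesis using * out(2) by metis
    qed
  qed
  moreover have "h ` A = B"
  proof (intro equalityI subsetI)
    show "b \<in> B" if "b \<in> h ` A" for b
    proof -
      from that obtain a where "a \<in> A" "b = h a" by blast
      then show ?thesis using out(1)[of a] f(2) by (cases "a \<in> D") (auto simp: h_def)
    qed
    show "b \<in> h ` A" if b: "b \<in> B" for b
    proof (cases "b \<in> f ` D")
      case True
      then obtain a where "a \<in> D" "b = f a" by blast
      then show ?thesis using DA by (intro image_eqI[of _ _ a]) (auto simp: h_def)
    next
      case False
      then have "g b \<in> A" "g b \<notin> D" using D_out[of "g b"] g b by (auto dest: inj_onD)
      moreover have "inv_into B g (g b) = b" using g(1) b by simp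
      ultimately show ?thesis by (intro image_eqI[of _ _ "g b"]) (auto simp: h_def)
    qed
  qed
  ultimately have "bij_betw h A B" by (simp add: bij_betw_def)
  moreover have "h a = f a \<or> g (h a) = a" if "a \<in> A" for a
    using out(2)[OF that] by (auto simp: h_def)
  ultimately show thesis by (rule that)
qed

context discrete_coarse_module
begin

section \<open>An orthonormal basis located at points of the space\<close>

definition module_basis where "module_basis = (\<Union>A\<in>\<P>. basis A)"

definition block where "block b = (SOME A. A \<in> \<P> \<and> b \<in> basis A)"

text \<open>Any point of the block would do: two choices differ by at most the gauge
  \<open>\<Delta>\<close>.\<close>

definition loc where "loc b = (SOME x. x \<in> block b)"

lemma P_basis_other_block:
  assumes "A \<in> \<P>" "B \<in> \<P>" "A \<noteq> B" "b \<in> basis B"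
  shows "P A b = 0"
proof -
  note AB = blocks(1)[OF assms(1)] blocks(1)[OF assms(2)]
  have "P A b = P A (P B b)" using P_basis[OF AB(2) assms(4)] by simp
  also have "\<dots> = 0" using P_Int[OF AB] block_disjoint[OF assms(1-3)] by (simp add: P_empty)
  finally show ?thesis .
qed

lemma basis_orthogonal:
  assumes "A \<in> \<P>" "B \<in> \<P>" "A \<noteq> B" "a \<in> basis A" "b \<in> basis B"
  shows "cinner a b = 0"
  using cinner_projection[OF P_projection, of A a b] P_basis[of A a] blocks(1)[OF assms(1)]
    P_basis_other_block[OF assms(1-3,5)] assms(4) by simp

lemma block:
  assumes "b \<in> module_basis"
  shows "block b \<in> \<P>" "b \<in> basis (block b)"
proof -
  have "\<exists>A. A \<in> \<P> \<and> b \<in> basis A" using assms by (auto simp: module_basis_def)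
  then have "block b \<in> \<P> \<and> b \<in> basis (block b)" unfolding block_def by (rule someI_ex)
  then show "block b \<in> \<P>" "b \<in> basis (block b)" by auto
qed

text \<open>A vector in the bases of two different blocks would be orthogonal to itself, so the
  choice made in \<open>block\<close> is forced.\<close>

lemma block_eq:
  assumes "A \<in> \<P>" "b \<in> basis A"
  shows "block b = A"
proof (rule ccontr)
  assume "block b \<noteq> A"
  moreover have "b \<in> module_basis" using assms by (auto simp: module_basis_def)
  ultimately have "cinner b b = 0" using block assms basis_orthogonal by blast
  then show False using orthonormal_nonzero[OF basis(1)[OF blocks(1)[OF assms(1)]] assms(2)] by simp
qed

lemma loc_block: "b \<in> module_basis \<Longrightarrow> loc b \<in> block b"
  unfolding loc_def using block_nonempty[OF block(1)] by (rule someI_ex)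

lemma loc_space: "b \<in> module_basis \<Longrightarrow> loc b \<in> X"
  by (rule block_space[OF block(1) loc_block])

lemma orthonormal_module_basis: "orthonormal module_basis"
  unfolding orthonormal_def
proof (intro ballI)
  fix a b assume ab: "a \<in> module_basis" "b \<in> module_basis"
  show "cinner a b = (if a = b then 1 else 0)"
  proof (cases "block a = block b")
    case True
    then show ?thesis
      using basis(1)[OF blocks(1)[OF block(1)[OF ab(1)]]] block(2)[OF ab(1)] block(2)[OF ab(2)]
      unfolding orthonormal_def by simp
  next
    case False
    then show ?thesis
      using basis_orthogonal[OF block(1)[OF ab(1)] block(1)[OF ab(2)] _ block(2)[OF ab(1)] block(2)[OF ab(2)]]
      by auto
  qed
qed

lemma closure_cspan_module_basis: "closure (cspan module_basis) = UNIV"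
proof (intro equalityI subsetI UNIV_I)
  fix v :: 'h
  have "P A v \<in> closure (cspan module_basis)" if "A \<in> \<P>" for A
  proof -
    have "P A v \<in> closure (cspan (basis A))" using basis(2)[OF blocks(1)[OF that]] by simp
    moreover have "basis A \<subseteq> module_basis" using that by (auto simp: module_basis_def)
    ultimately show ?thesis using closure_mono[OF complex_vector.span_mono] by blast
  qed
  then have "sum (\<lambda>A. P A v) F \<in> closure (cspan module_basis)" if "F \<subseteq> \<P>" for F
    using that by (intro complex_vector.subspace_sum[OF csubspace_closure_cspan]) auto
  then have "\<forall>\<^sub>F F in finite_subsets_at_top \<P>. sum (\<lambda>A. P A v) F \<in> closure (cspan module_basis)"
    by (intro eventually_finite_subsets_at_top_weakI) auto
  then show "v \<in> closure (cspan module_basis)"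
    using blocks_sum[of v] unfolding has_sum_def
    by (intro Lim_in_closed_set[OF closed_closure]) auto
qed

text \<open>For a nonzero entry at \<open>(y, x)\<close> there is a basis vector \<open>b\<close>
  near \<open>x\<close> whose image lies in the block of \<open>y\<close>. The chain is
  \<open>y\<close>, \<open>loc (\<beta> b)\<close>, \<open>f (loc b)\<close>,
  \<open>f x\<close>.\<close>

lemma block_supp_le_graph:
  assumes u: "bounded_clinear u" "\<And>b. b \<in> module_basis \<Longrightarrow> u b = \<beta> b"
    and \<beta>: "\<And>b. b \<in> module_basis \<Longrightarrow> \<beta> b \<in> module_basis"
    and f: "cmap f" and cl: "close \<E> module_basis (loc \<circ> \<beta>) (f \<circ> loc)"
  shows "coarse_le \<E> (block_supp u) (graph X f)"
  unfolding coarse_le_graph_iff[OF f block_supp_space]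
proof -
  obtain K where K: "K \<in> \<E>" "\<And>b. b \<in> module_basis \<Longrightarrow> (loc (\<beta> b), f (loc b)) \<in> K"
    using closeD[OF cl] by auto
  define M where "M = map_prod f f ` \<Delta>"
  have M: "M \<in> \<E>" using f gauge_ent by (simp add: M_def cmap_def)
  have ent: "\<Delta> O K O M \<in> \<E>" using M K(1) gauge_ent by (intro ent_comp)
  show "close \<E> (block_supp u) fst (f \<circ> snd)"
  proof (rule closeI[OF ent])
    fix i assume "i \<in> block_supp u"
    moreover obtain y x where i: "i = (y, x)" by fastforce
    ultimately obtain B A v where AB: "B \<in> \<P>" "A \<in> \<P>" "y \<in> B" "x \<in> A" "P B (u (P A v)) \<noteq> 0"
      using block_suppE by metis
    have lin: "bounded_clinear (P B \<circ> u)" by (rule bounded_clinear_comp[OF P_linear[OF blocks(1)[OF AB(1)]] u(1)])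
    \<comment> \<open>Otherwise the bounded operator \<open>P B \<circ> u\<close> would vanish on
      the closed span of \<open>basis A\<close>, which is the image of \<open>P A\<close>.\<close>
    have "\<exists>b\<in>basis A. P B (u b) \<noteq> 0"
    proof (rule ccontr)
      assume "\<not> ?thesis"
      then have "basis A \<subseteq> {w. (P B \<circ> u) w = 0}" by auto
      moreover have "P A v \<in> closure (cspan (basis A))" using basis(2)[OF blocks(1)[OF AB(2)]] by simp
      moreover have "closed {w. (P B \<circ> u) w = 0}"
        by (intro closed_Collect_eq bounded_clinearD(6)[OF lin] continuous_on_const)
      moreover have "complex_vector.subspace {w. (P B \<circ> u) w = 0}"
        unfolding complex_vector.subspace_def by (simp add: bounded_clinearD(2-4)[OF lin, simplified])
      ultimately have "P A v \<in> {w. (P B \<circ> u) w = 0}" using closure_cspan_induct by blast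
      then show False using AB(5) by simp
    qed
    then obtain b where b: "b \<in> basis A" "P B (u b) \<noteq> 0" by blast
    have bB: "b \<in> module_basis" using b(1) AB(2) by (auto simp: module_basis_def)
    note \<beta>b = \<beta>[OF bB]
    \<comment> \<open>The image of \<open>b\<close> is a single basis vector, and \<open>P B\<close>
      kills those of all other blocks.\<close>
    have "block (\<beta> b) = B"
      using P_basis_other_block[OF AB(1) block(1)[OF \<beta>b] _ block(2)[OF \<beta>b]] b(2) u(2)[OF bB] by auto
    then have "(y, loc (\<beta> b)) \<in> \<Delta>" using block_gauge[OF AB(1,3)] loc_block[OF \<beta>b] by simp
    moreover have "(loc b, x) \<in> \<Delta>"
      using block_gauge[OF AB(2) _ AB(4)] loc_block[OF bB] block_eq[OF AB(2) b(1)] by simp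
    then have "(f (loc b), f x) \<in> M" by (auto simp: M_def)
    ultimately show "(fst i, (f \<circ> snd) i) \<in> \<Delta> O K O M"
      using K(2)[OF bB] unfolding i by auto
  qed
qed

text \<open>All basis vectors sent near the same good block \<open>h\<close> live over one bounded set, because \<open>f\<close> is
  a coarse embedding. Hence there are at most \<open>\<kappa>\<close> of them, and they fit into the basis of \<open>h\<close>.\<close>

lemma basis_injection:
  assumes fg: "coarse_inverses f g"
  obtains \<beta> where "inj_on \<beta> module_basis" "\<beta> ` module_basis \<subseteq> module_basis" "close \<E> module_basis (loc \<circ> \<beta>) (f \<circ> loc)"
proof -
  have f: "cmap f" and g: "cmap g" and gf: "close \<E> X (g \<circ> f) id"
    using fg by (auto simp: coarse_inverses_def)
  obtain F where F: "F \<in> \<E>" "\<And>x. x \<in> X \<Longrightarrow> \<exists>A. good A \<and> (\<exists>a\<in>A. (x, a) \<in> F)"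
    using good_dense by blast
  have "\<exists>A. good A \<and> (\<exists>a\<in>A. (f (loc b), a) \<in> F)" if "b \<in> module_basis" for b
    using F(2) loc_space[OF that] cmap_space[OF f] by blast
  \<comment> \<open>The block containing \<open>f (loc b)\<close> may have too small a basis, so a
    nearby good block is the target.\<close>
  then obtain \<tau> where \<tau>: "\<And>b. b \<in> module_basis \<Longrightarrow> good (\<tau> b)" "\<And>b. b \<in> module_basis \<Longrightarrow> \<exists>a\<in>\<tau> b. (f (loc b), a) \<in> F"
    by metis
  obtain K where K: "K \<in> \<E>" "\<And>x. x \<in> X \<Longrightarrow> (g (f x), x) \<in> K"
    using closeD[OF gf] by auto
  define M where "M = map_prod g g ` (F O \<Delta> O F\<inverse>)"
  have M: "M \<in> \<E>"
    using g ent_comp[OF F(1) ent_comp[OF gauge_ent ent_converse[OF F(1)]]] by (simp add: M_def cmap_def)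
  \<comment> \<open>Follows the chain \<open>x\<close>, \<open>loc b\<close>,
    \<open>g (f (loc b))\<close>, \<open>g (f (loc c))\<close>, \<open>loc c\<close>,
    \<open>y\<close>; the middle link is \<open>M\<close>, since both \<open>f (loc b)\<close> and
    \<open>f (loc c)\<close> are near the same block.\<close>
  define N where "N = \<Delta> O K\<inverse> O M O K O \<Delta>"
  have N: "N \<in> \<E>" unfolding N_def by (intro ent_comp gauge_ent ent_converse K(1) M)
  have "|{b \<in> module_basis. \<tau> b = h}| \<le>o |basis h|" if h: "good h" for h
  proof -
    define T where "T = {b \<in> module_basis. \<tau> b = h}"
    define C where "C = (\<Union>b\<in>T. block b)"
    have hP: "h \<in> \<P>" using h by (simp add: good_def)
    have bT: "b \<in> module_basis" "\<tau> b = h" if "b \<in> T" for b using that by (auto simp: T_def)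
    \<comment> \<open>\<open>C\<close> may be an infinite union of blocks; it meets each block in
      all or nothing, so completeness of the algebra along the partition applies.\<close>
    have C: "C \<in> \<AA>"
    proof (rule blocks_complete)
      show "C \<subseteq> X" using block_space[OF block(1)[OF bT(1)]] by (auto simp: C_def)
      fix A assume A: "A \<in> \<P>"
      show "C \<inter> A \<in> \<AA>"
      proof (cases "A \<in> block ` T")
        case True
        then have "C \<inter> A = A" by (auto simp: C_def)
        then show ?thesis using blocks(1)[OF A] by simp
      next
        case False
        have "block b \<inter> A = {}" if "b \<in> T" for b
          using block_disjoint[OF block(1)[OF bT(1)[OF that]] A] False that by blast
        then have "C \<inter> A = {}" by (auto simp: C_def)
        then show ?thesis by (simp add: meas_empty)
      qed
    qed
    have "C \<times> C \<subseteq> N"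
    proof (rule subrelI)
      fix x y assume "(x, y) \<in> C \<times> C"
      then obtain b c where bc: "b \<in> T" "c \<in> T" "x \<in> block b" "y \<in> block c" by (auto simp: C_def)
      note B = bT[OF bc(1)] bT[OF bc(2)]
      obtain p q where "p \<in> h" "q \<in> h" "(f (loc b), p) \<in> F" "(f (loc c), q) \<in> F"
        using \<tau>(2)[OF B(1)] \<tau>(2)[OF B(3)] B by auto
      then have "(f (loc b), f (loc c)) \<in> F O \<Delta> O F\<inverse>" using block_gauge[OF hP] by blast
      then have "(g (f (loc b)), g (f (loc c))) \<in> M" by (auto simp: M_def)
      moreover have "(x, loc b) \<in> \<Delta>" "(loc c, y) \<in> \<Delta>"
        using block_gauge[OF block(1)] B loc_block bc by auto
      moreover have "(g (f (loc b)), loc b) \<in> K" "(g (f (loc c)), loc c) \<in> K"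
        using K(2) loc_space B by auto
      ultimately show "(x, y) \<in> N" unfolding N_def by (meson converseI relcompI)
    qed
    then have "C \<times> C \<in> \<E>" by (rule ent_subset[OF N])
    then have "|basis C| \<le>o \<kappa>"
      using local_rank C unfolding local_rank_le_def projection_rank_basis by blast
    \<comment> \<open>\<open>T\<close> is itself an orthonormal set in the image of
      \<open>P C\<close>, so the rank of \<open>P C\<close> bounds its size, for finite \<kappa> as
      well.\<close>
    moreover have "|T| \<le>o |basis C|"
    proof (rule card_le_basis[OF C])
      show "orthonormal T" using orthonormal_subset[OF orthonormal_module_basis] by (auto simp: T_def)
      fix b assume b: "b \<in> T"
      note bm = blocks(1)[OF block(1)[OF bT(1)[OF b]]]
      show "P C b = b"
        by (rule P_subset[OF bm C]) (use b P_basis[OF bm block(2)[OF bT(1)[OF b]]] in \<open>auto simp: C_def\<close>)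
    qed
    moreover have "\<kappa> \<le>o |basis h|" using h by (simp add: good_def)
    ultimately show ?thesis unfolding T_def by (meson ordLeq_transitive)
  qed
  then have "\<exists>k. inj_on k {b \<in> module_basis. \<tau> b = h} \<and> k ` {b \<in> module_basis. \<tau> b = h} \<subseteq> basis h" if "good h" for h
    using that card_of_ordLeq by blast
  then have "\<forall>h. \<exists>k. good h \<longrightarrow>
      inj_on k {b \<in> module_basis. \<tau> b = h} \<and> k ` {b \<in> module_basis. \<tau> b = h} \<subseteq> basis h" by blast
  from choice[OF this] obtain k where
    k: "\<And>h. good h \<Longrightarrow> inj_on (k h) {b \<in> module_basis. \<tau> b = h}"
      "\<And>h. good h \<Longrightarrow> k h ` {b \<in> module_basis. \<tau> b = h} \<subseteq> basis h" by blast
  \<comment> \<open>The block of \<open>\<beta> b\<close> recovers \<open>\<tau> b\<close>, so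
    injectivity on each fibre of \<open>\<tau>\<close> gives injectivity overall.\<close>
  define \<beta> where "\<beta> b = k (\<tau> b) b" for b
  have \<beta>: "\<beta> b \<in> basis (\<tau> b)" "\<tau> b \<in> \<P>" if "b \<in> module_basis" for b
    using k(2)[OF \<tau>(1)[OF that]] that \<tau>(1)[OF that] by (auto simp: \<beta>_def good_def)
  then have \<beta>B: "\<beta> b \<in> module_basis" if "b \<in> module_basis" for b using that by (auto simp: module_basis_def)
  have \<beta>\<tau>: "block (\<beta> b) = \<tau> b" if "b \<in> module_basis" for b by (rule block_eq[OF \<beta>(2,1)]) (use that in auto)
  have "inj_on \<beta> module_basis"
  proof (rule inj_onI)
    fix b c assume bc: "b \<in> module_basis" "c \<in> module_basis" "\<beta> b = \<beta> c"
    then have eq: "\<tau> b = \<tau> c" using \<beta>\<tau> by metis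
    then have "k (\<tau> b) b = k (\<tau> b) c" using bc(3) by (simp add: \<beta>_def)
    then show "b = c" using inj_onD[OF k(1)[OF \<tau>(1)[OF bc(1)]]] bc eq by simp
  qed
  moreover have "close \<E> module_basis (loc \<circ> \<beta>) (f \<circ> loc)"
  proof (rule closeI)
    show "\<Delta> O F\<inverse> \<in> \<E>" by (intro ent_comp gauge_ent ent_converse F(1))
    fix b assume b: "b \<in> module_basis"
    obtain a where "a \<in> \<tau> b" "(f (loc b), a) \<in> F" using \<tau>(2)[OF b] by blast
    moreover have "loc (\<beta> b) \<in> \<tau> b" using loc_block[OF \<beta>B[OF b]] \<beta>\<tau>[OF b] by simp
    ultimately show "((loc \<circ> \<beta>) b, (f \<circ> loc) b) \<in> \<Delta> O F\<inverse>"
      using block_gauge[OF \<beta>(2)[OF b]] by auto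
  qed
  ultimately show thesis using that \<beta>B by blast
qed

lemma basis_bijection:
  assumes fg: "coarse_inverses f g"
  obtains \<beta> where "bij_betw \<beta> module_basis module_basis" "close \<E> module_basis (loc \<circ> \<beta>) (f \<circ> loc)"
proof -
  have gf: "coarse_inverses g f" using fg by (auto simp: coarse_inverses_def)
  have f: "cmap f" "close \<E> X (f \<circ> g) id" using fg by (auto simp: coarse_inverses_def)
  obtain \<beta>1 where 1: "inj_on \<beta>1 module_basis" "\<beta>1 ` module_basis \<subseteq> module_basis" "close \<E> module_basis (loc \<circ> \<beta>1) (f \<circ> loc)"
    by (rule basis_injection[OF fg])
  obtain \<beta>2 where 2: "inj_on \<beta>2 module_basis" "\<beta>2 ` module_basis \<subseteq> module_basis" "close \<E> module_basis (loc \<circ> \<beta>2) (g \<circ> loc)"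
    by (rule basis_injection[OF gf])
  obtain \<beta> where \<beta>: "bij_betw \<beta> module_basis module_basis" "\<And>b. b \<in> module_basis \<Longrightarrow> \<beta> b = \<beta>1 b \<or> \<beta>2 (\<beta> b) = b"
    using Schroeder_Bernstein_pointwise[OF 1(1,2) 2(1,2)] by blast
  have "close \<E> module_basis (f \<circ> (g \<circ> loc)) (id \<circ> loc)"
    using close_reindex[OF f(2), of loc module_basis] loc_space by (simp add: comp_assoc)
  then have "close \<E> module_basis (f \<circ> (loc \<circ> \<beta>2)) loc"
    using close_trans[OF cmap_close[OF f(1) 2(3)]] by simp
  then obtain E where E: "E \<in> \<E>" "\<And>b. b \<in> module_basis \<Longrightarrow> (loc b, f (loc (\<beta>2 b))) \<in> E"
    using closeD[OF close_sym] by fastforce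
  obtain F where F: "F \<in> \<E>" "\<And>b. b \<in> module_basis \<Longrightarrow> (loc (\<beta>1 b), f (loc b)) \<in> F"
    using closeD[OF 1(3)] by auto
  have "close \<E> module_basis (loc \<circ> \<beta>) (f \<circ> loc)"
  proof (rule closeI[OF ent_Un[OF E(1) F(1)]])
    fix b assume b: "b \<in> module_basis"
    \<comment> \<open>If \<open>\<beta> b = \<beta>1 b\<close>, use \<open>F\<close> at
      \<open>b\<close>. If \<open>\<beta>2 (\<beta> b) = b\<close>, use \<open>E\<close> at
      \<open>\<beta> b\<close>: its second entry is then \<open>f (loc b)\<close>.\<close>
    show "((loc \<circ> \<beta>) b, (f \<circ> loc) b) \<in> E \<union> F"
      using \<beta>(2)[OF b] F(2)[OF b] E(2)[OF bij_betw_apply[OF \<beta>(1) b]] by auto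
  qed
  with \<beta>(1) show thesis by (rule that)
qed

lemma coarse_support_surj:
  assumes "C \<in> carrier (CE X \<E>)"
  shows "\<exists>u\<in>carrier (CtrUni X \<E> \<AA> P). coarse_support X \<E> \<AA> P u = C"
proof -
  obtain f g where C: "C = fun_class X \<E> f" and fg: "coarse_inverses f g"
    using assms unfolding CE_carrier by blast
  have f: "cmap f" and g: "cmap g" and gf: "close \<E> X (g \<circ> f) id"
    using fg by (auto simp: coarse_inverses_def)
  obtain \<beta> where \<beta>: "bij_betw \<beta> module_basis module_basis" "close \<E> module_basis (loc \<circ> \<beta>) (f \<circ> loc)"
    by (rule basis_bijection[OF fg])
  define \<gamma> where "\<gamma> = inv_into module_basis \<beta>"
  have \<gamma>: "bij_betw \<gamma> module_basis module_basis" unfolding \<gamma>_def by (rule bij_betw_inv_into[OF \<beta>(1)])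
  obtain u where u: "unitary u" "\<And>b. b \<in> module_basis \<Longrightarrow> u b = \<beta> b" "\<And>b. b \<in> module_basis \<Longrightarrow> cadjoint u b = \<gamma> b"
    using orthonormal_bij_unitary[OF orthonormal_module_basis closure_cspan_module_basis \<beta>(1)] unfolding \<gamma>_def by blast
  have \<gamma>B: "\<gamma> \<in> module_basis \<rightarrow> module_basis" using bij_betw_apply[OF \<gamma>] by blast
  \<comment> \<open>To see that \<open>\<gamma>\<close> covers \<open>g\<close>, the estimate for
    \<open>\<beta>\<close> is evaluated at \<open>\<gamma> b\<close> and pushed through
    \<open>g\<close>: \<open>loc (\<gamma> b)\<close> is near
    \<open>g (f (loc (\<gamma> b)))\<close>, hence near \<open>g (loc b)\<close>. This controls the
    adjoint.\<close>
  have "close \<E> module_basis (g \<circ> (loc \<circ> \<beta> \<circ> \<gamma>)) (g \<circ> (f \<circ> loc \<circ> \<gamma>))"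
    by (intro cmap_close[OF g] close_reindex[OF \<beta>(2) \<gamma>B])
  moreover have "close \<E> module_basis (g \<circ> f \<circ> (loc \<circ> \<gamma>)) (id \<circ> (loc \<circ> \<gamma>))"
    by (rule close_reindex[OF gf]) (use loc_space \<gamma>B in \<open>auto simp: Pi_iff\<close>)
  ultimately have "close \<E> module_basis (g \<circ> (loc \<circ> \<beta> \<circ> \<gamma>)) (loc \<circ> \<gamma>)"
    using close_trans by (simp add: comp_assoc) blast
  then have "close \<E> module_basis (loc \<circ> \<gamma>) (g \<circ> (loc \<circ> \<beta> \<circ> \<gamma>))" by (rule close_sym)
  moreover have "(g \<circ> (loc \<circ> \<beta> \<circ> \<gamma>)) b = (g \<circ> loc) b" if "b \<in> module_basis" for b
    using bij_betw_inv_into_right[OF \<beta>(1) that] by (simp add: \<gamma>_def)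
  ultimately have cl: "close \<E> module_basis (loc \<circ> \<gamma>) (g \<circ> loc)"
    unfolding close_def by (simp cong: image_cong_simp)
  have le: "coarse_le \<E> (block_supp u) (graph X f)"
    by (rule block_supp_le_graph[OF unitary_clinear[OF u(1)] u(2) bij_betw_apply[OF \<beta>(1)] f \<beta>(2)])
  have "coarse_le \<E> (block_supp (cadjoint u)) (graph X g)"
    by (rule block_supp_le_graph[OF unitary_clinear[OF unitary_cadjoint[OF u(1)]] u(3) bij_betw_apply[OF \<gamma>] g cl])
  then have "coarse_le \<E> ((block_supp u)\<inverse>) (graph X g)"
    by (simp only: block_supp_cadjoint[OF unitary_clinear[OF u(1)]])
  then have "u \<in> carrier (CtrUni X \<E> \<AA> P)"
    using controlled_rel_le[OF controlled_rel_graph[OF f] le] controlled_rel_le[OF controlled_rel_graph[OF g]] u(1)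
    by (simp add: CtrUni_carrier_iff)
  moreover have "coarse_support X \<E> \<AA> P u = C"
    unfolding C by (rule iffD2[OF coarse_support_eq_fun_class_iff[OF u(1) f] le])
  ultimately show ?thesis by blast
qed

end

text \<open>\<open>\<rho>\<close> is the inverse of the map in the first isomorphism theorem. Its
  values are cosets of the kernel, and these are the fibres of \<open>h\<close>; the formula
  determines \<open>\<rho>\<close> on the carrier and so makes "canonical" precise.\<close>

lemma (in group_hom) FactGroup_iso_fibres:
  assumes surj: "h ` carrier G = carrier H"
  shows "\<exists>\<rho>\<in>iso H (G Mod kernel G H h). \<forall>y\<in>carrier H. \<rho> y = {x \<in> carrier G. h x = y}"
proof
  let ?Q = "G Mod kernel G H h" and ?\<theta> = "\<lambda>K. the_elem (h ` K)"
  have iso: "?\<theta> \<in> iso ?Q H" by (rule FactGroup_iso_set[OF surj])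
  have "group ?Q" by (rule normal.factorgroup_is_group[OF normal_kernel])
  then show "inv_into (carrier ?Q) ?\<theta> \<in> iso H ?Q" using iso by (rule group.iso_set_sym)
  show "\<forall>y\<in>carrier H. inv_into (carrier ?Q) ?\<theta> y = {x \<in> carrier G. h x = y}"
  proof
    fix y assume "y \<in> carrier H"
    then have "y \<in> h ` carrier G" by (simp only: surj)
    then obtain x where x: "x \<in> carrier G" "h x = y" by blast
    let ?K = "kernel G H h #> x"
    have K: "?K \<in> carrier ?Q" using x(1) by (auto simp: carrier_FactGroup)
    have K_eq: "?K = {z \<in> carrier G. h z = y}"
    proof (intro equalityI subsetI)
      fix z assume "z \<in> ?K"
      then show "z \<in> {z \<in> carrier G. h z = y}" using x by (auto simp: r_coset_def kernel_def)
    next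
      fix z assume z: "z \<in> {z \<in> carrier G. h z = y}"
      then have "z \<otimes> inv x \<in> kernel G H h" "z = (z \<otimes> inv x) \<otimes> x"
        using x by (auto simp: kernel_def G.m_assoc)
      then show "z \<in> ?K" unfolding r_coset_def by blast
    qed
    have "h ` ?K = {y}" using x by (auto simp: K_eq)
    then have "?\<theta> ?K = y" by simp
    then have "inv_into (carrier ?Q) ?\<theta> y = ?K" by (rule inv_into_f_eq[OF FactGroup_inj_on K])
    then show "inv_into (carrier ?Q) ?\<theta> y = {x \<in> carrier G. h x = y}" by (simp only: K_eq)
  qed
qed

theorem theorem7p16:
  fixes X :: "'a set" and \<E> :: "('a \<times> 'a) set set" and \<AA> :: "'a set set"
    and P :: "'a set \<Rightarrow> 'h::chilbert_space \<Rightarrow> 'h" and \<kappa> :: "'k rel"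
  assumes "coarse_space X \<E>"
    and "coarse_module X \<E> \<AA> P"
    and "discrete_module X \<E> \<AA> P"
    and "Card_order \<kappa>" and "Field \<kappa> \<noteq> {}"
    and "ample_module X \<E> \<AA> P \<kappa>"
    and "local_rank_le \<E> \<AA> P \<kappa>"
  shows "group (CE X \<E>) \<and>
    group (CtrUni X \<E> \<AA> P) \<and>
    UCcp \<E> \<AA> P \<lhd> CtrUni X \<E> \<AA> P \<and>
    (\<exists>\<rho> \<in> iso (CE X \<E>) (CtrUni X \<E> \<AA> P Mod UCcp \<E> \<AA> P).
       \<forall>F \<in> carrier (CE X \<E>).
         \<rho> F = {u \<in> carrier (CtrUni X \<E> \<AA> P). coarse_support X \<E> \<AA> P u = F})"
proof -
  obtain \<Delta> \<P> where "coarse_gauge X \<E> \<Delta>" "partition_on X \<P>"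
      "\<forall>A\<in>\<P>. A \<in> \<AA> \<and> A \<times> A \<subseteq> \<Delta>" "\<forall>v. ((\<lambda>A. P A v) has_sum v) \<P>"
      "\<forall>C. C \<subseteq> X \<and> (\<forall>A\<in>\<P>. C \<inter> A \<in> \<AA>) \<longrightarrow> C \<in> \<AA>"
    using assms(3) unfolding discrete_module_def by (elim exE conjE) blast
  then interpret discrete_coarse_module X \<E> \<AA> P \<P> \<Delta> \<kappa>
    using assms by unfold_locales auto
  have "coarse_support X \<E> \<AA> P ` carrier (CtrUni X \<E> \<AA> P) = carrier (CE X \<E>)"
    using coarse_support_CE coarse_support_surj by (auto simp: image_iff)
  from support.FactGroup_iso_fibres[OF this] show ?thesis
    using support.normal_kernel group_CE group_CtrUni unfolding kernel_support by (intro conjI)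
qed

end
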